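(* Let $(S,\sigma)$ and $(T,\tau)$ be finitely correlated, isometric, fully coisometric representations of a $C^*$-correspondence $E$ on Hilbert spaces $\mathcal{H}_S$ and $\mathcal{H}_T$ respectively. Let $\mathcal{V}_S$ be the unique minimal cyclic coinvariant subspace for $(S,\sigma)$ and let $\mathcal{V}_T$ be the unique minimal cyclic coinvariant subspace for $(T,\tau)$. Then $(S,\sigma)$ and $(T,\tau)$ are unitarily equivalent if and only if the finite dimensional representations $(P_{\mathcal{V}_S}S(\cdot)|_{\mathcal{V}_S},\sigma(\cdot)|_{\mathcal{V}_S})$ and $(P_{\mathcal{V}_T}T(\cdot)|_{\mathcal{V}_T},\tau(\cdot)|_{\mathcal{V}_T})$ are unitarily equivalent.
   Context: Conventions. All $C^*$-algebras and their representations on Hilbert spaces are unital; subspaces are closed. A $C^*$-correspondence $E$ over $\mathcal A$ is a right Hilbert $C^*$-module over $\mathcal A$ ($\mathcal A$-valued inner product conjugate linear in the first variable) with a left action of $\mathcal A$ given by a $*$-homomorphism $\varphi:\mathcal A\to\mathcal L(E)$ into the adjointable operators. A representation $(A,\sigma)$ of $E$ on a Hilbert space $\mathcal V$ is a completely contractive linear map $A:E\to\mathcal B(\mathcal V)$ and a unital representation $\sigma$ of $\mathcal A$ on $\mathcal V$ with $A(a\xi b)=\sigma(a)A(\xi)\sigma(b)$. $E\otimes_\sigma\mathcal V$ is the Hausdorff completion of the algebraic tensor product with respect to $\langle\xi_1\otimes h_1,\xi_2\otimes h_2\rangle=\langle h_1,\sigma(\langle\xi_1,\xi_2\rangle)h_2\rangle$,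 and $\tilde A:E\otimes_\sigma\mathcal V\to\mathcal V$ is the contraction $\tilde A(\xi\otimes h)=A(\xi)h$. $(A,\sigma)$ is isometric if $A(\xi)^*A(\eta)=\sigma(\langle\xi,\eta\rangle)$ for all $\xi,\eta$, and fully coisometric if $\tilde A\tilde A^*=I$. $E^n$ is the $n$-fold interior tensor product of $E$ with itself ($E^0=\mathcal A$), and $\tilde A_n:E^n\otimes_\sigma\mathcal V\to\mathcal V$ is $\tilde A_n(\xi_1\otimes\cdots\otimes\xi_n\otimes h)=A(\xi_1)\cdots A(\xi_n)h$. Two representations are unitarily equivalent if a single unitary between the Hilbert spaces intertwines both the maps on $E$ and the representations of $\mathcal A$. A representation $(S,\rho)$ on $\mathcal H\supseteq\mathcal V$ is a dilation of $(A,\sigma)$ if $\mathcal V$ reduces $\rho$ with $\rho(a)|_{\mathcal V}=\sigma(a)$, $\mathcal V^\perp$ is invariant under every $S(\xi)$, and $P_{\mathcal V}S(\xi)|_{\mathcal V}=A(\xi)$. It is an isometric dilation if $(S,\rho)$ is isometric, and minimal if $\mathcal H=\bigvee_{n\ge0}\tilde S_n(E^n\otimes\mathcal V)$. Every representation has a minimal isometric dilation, unique up to a unitary equivalence fixing $\mathcal V$ (Muhly–Solel). An isometric representation is finitely correlated if it is the minimal isometric dilation of a representation on a non-zero finite dimensional subspace. The unital WOT-closed algebra $\mathfrak S$ generated by $(S,\rho)$ is the WOT-closure of the algebra generated by $I$, all $S(\xi)$ and all $\rho(a)$. A subspace $\mathcal V'$ is cyclic for $\mathfrak S$ on $\mathcal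 H$ if the closed span of $\mathfrak S\mathcal V'$ is $\mathcal H$. A minimal cyclic coinvariant subspace for $(S,\rho)$ is an $\mathfrak S^*$-invariant subspace which is cyclic for $\mathfrak S$ and which has no proper $\mathfrak S^*$-invariant subspace that is cyclic for $\mathfrak S$. (For a finitely correlated, fully coisometric representation such a subspace exists, is unique, and is finite dimensional.) *)

theory Defs
  imports "HOL-Analysis.Analysis" "HOL-Library.Poly_Mapping"
begin

section \<open>Complex vector spaces, Hilbert spaces and unital C*-algebras\<close>

class complex_vector = real_vector +
  fixes scaleC :: "complex \<Rightarrow> 'a \<Rightarrow> 'a"
  assumes scaleC_add_right: "scaleC c (x + y) = scaleC c x + scaleC c y"
    and scaleC_add_left: "scaleC (c + d) x = scaleC c x + scaleC d x"
    and scaleC_scaleC: "scaleC c (scaleC d x) = scaleC (c * d) x"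
    and scaleC_one: "scaleC 1 x = x"
    and scaleR_scaleC: "scaleR r x = scaleC (complex_of_real r) x"

global_interpretation complex_vector: vector_space "scaleC :: complex \<Rightarrow> 'a \<Rightarrow> 'a::complex_vector"
  by unfold_locales (rule scaleC_add_right scaleC_add_left scaleC_scaleC scaleC_one)+

abbreviation csubspace :: "'a::complex_vector set \<Rightarrow> bool"
  where "csubspace \<equiv> module.subspace scaleC"

abbreviation cspan :: "'a::complex_vector set \<Rightarrow> 'a set"
  where "cspan \<equiv> module.span scaleC"

class complex_normed_vector = complex_vector + real_normed_vector +
  assumes norm_scaleC: "norm (scaleC c x) = cmod c * norm x"

class complex_banach = complex_normed_vector + complete_space

class chilbert_space = complex_banach +
  fixes cinner :: "'a \<Rightarrow> 'a \<Rightarrow> complex"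
  assumes cinner_commute: "cinner x y = cnj (cinner y x)"
    and cinner_add_right: "cinner x (y + z) = cinner x y + cinner x z"
    and cinner_scaleC_right: "cinner x (scaleC c y) = c * cinner x y"
    and cinner_norm: "cinner x x = complex_of_real ((norm x)\<^sup>2)"

text \<open>The class \<^class>\<open>real_normed_algebra_1\<close> makes the algebra non-zero. This loses nothing: the zero
  algebra has no unital representation on a non-zero space.\<close>

class cstar_algebra = complex_banach + real_normed_algebra_1 +
  fixes star :: "'a \<Rightarrow> 'a"
  assumes mult_scaleC_left: "scaleC c x * y = scaleC c (x * y)"
    and mult_scaleC_right: "x * scaleC c y = scaleC c (x * y)"
    and star_add: "star (x + y) = star x + star y"
    and star_scaleC: "star (scaleC c x) = scaleC (cnj c) (star x)"
    and star_mult: "star (x * y) = star y * star x"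
    and star_star: "star (star x) = x"
    and cstar_identity: "norm (star x * x) = (norm x)\<^sup>2"

section \<open>C*-correspondences\<close>

record ('a, 'e) correspondence =
  mip :: "'e \<Rightarrow> 'e \<Rightarrow> 'a"
  ract :: "'e \<Rightarrow> 'a \<Rightarrow> 'e"
  lact :: "'a \<Rightarrow> 'e \<Rightarrow> 'e"

text \<open>The last assumption says both that each \<open>lact a\<close> is adjointable and that \<open>lact\<close> preserves the
  involution. The left action is not required to be unital.\<close>

locale cstar_correspondence =
  fixes E :: "('a::cstar_algebra, 'e::complex_banach) correspondence"
  assumes ract_add_left: "ract E (x + y) a = ract E x a + ract E y a"
    and ract_add_right: "ract E x (a + b) = ract E x a + ract E x b"
    and ract_mult: "ract E x (a * b) = ract E (ract E x a) b"
    and ract_one: "ract E x 1 = x"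
    and ract_scaleC_left: "ract E (scaleC c x) a = scaleC c (ract E x a)"
    and ract_scaleC_right: "ract E x (scaleC c a) = scaleC c (ract E x a)"
    and mip_add_right: "mip E x (y + z) = mip E x y + mip E x z"
    and mip_scaleC_right: "mip E x (scaleC c y) = scaleC c (mip E x y)"
    and mip_ract_right: "mip E x (ract E y a) = mip E x y * a"
    and mip_star: "star (mip E x y) = mip E y x"
    and mip_positive: "\<exists>b. mip E x x = star b * b"
    and mip_norm: "norm x = sqrt (norm (mip E x x))"
    and lact_add_right: "lact E a (x + y) = lact E a x + lact E a y"
    and lact_scaleC_right: "lact E a (scaleC c x) = scaleC c (lact E a x)"
    and lact_add_left: "lact E (a + b) x = lact E a x + lact E b x"
    and lact_scaleC_left: "lact E (scaleC c a) x = scaleC c (lact E a x)"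
    and lact_mult: "lact E (a * b) x = lact E a (lact E b x)"
    and lact_adjoint: "mip E (lact E a x) y = mip E x (lact E (star a) y)"

subsection \<open>Matrix norms\<close>

text \<open>An \<open>n \<times> n\<close> matrix over \<open>'a\<close> has its C*-norm, the operator norm on the Hilbert module \<open>'a\<^sup>n\<close> of
  columns. The norm of a matrix over \<open>'e\<close> comes from the \<open>M\<^sub>n('a)\<close>-valued inner product
  \<open>\<langle>\<xi>, \<eta>\<rangle>\<^sub>i\<^sub>j = \<Sum>k. \<langle>\<xi>\<^sub>k\<^sub>i, \<eta>\<^sub>k\<^sub>j\<rangle>\<close>. Only entries with indices below \<open>n\<close> matter, and quotients with
  denominator \<open>0\<close> contribute \<open>0\<close> to the supremum, as in \<^const>\<open>onorm\<close>.\<close>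

definition column_norm :: "nat \<Rightarrow> (nat \<Rightarrow> 'a::cstar_algebra) \<Rightarrow> real"
  where "column_norm n x = sqrt (norm (\<Sum>i<n. star (x i) * x i))"

definition matrix_norm :: "nat \<Rightarrow> (nat \<Rightarrow> nat \<Rightarrow> 'a::cstar_algebra) \<Rightarrow> real"
  where "matrix_norm n a = (SUP x. column_norm n (\<lambda>i. \<Sum>j<n. a i j * x j) / column_norm n x)"

definition module_matrix_norm ::
    "('a::cstar_algebra, 'e) correspondence \<Rightarrow> nat \<Rightarrow> (nat \<Rightarrow> nat \<Rightarrow> 'e) \<Rightarrow> real"
  where "module_matrix_norm E n \<xi> = sqrt (matrix_norm n (\<lambda>i j. \<Sum>k<n. mip E (\<xi> k i) (\<xi> k j)))"

section \<open>Operators on subspaces\<close>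

text \<open>An operator on a closed subspace \<open>V\<close> is a function on the ambient type whose values outside \<open>V\<close>
  are never used. The whole Hilbert space is \<open>V = UNIV\<close>.\<close>

definition closed_csubspace :: "'h::complex_normed_vector set \<Rightarrow> bool"
  where "closed_csubspace V \<longleftrightarrow> csubspace V \<and> closed V"

definition finite_dim :: "'h::complex_vector set \<Rightarrow> bool"
  where "finite_dim V \<longleftrightarrow> (\<exists>B. finite B \<and> V = cspan B)"

definition ortho :: "'h::chilbert_space set \<Rightarrow> 'h set"
  where "ortho V = {x. \<forall>v\<in>V. cinner v x = 0}"

definition proj :: "'h::chilbert_space set \<Rightarrow> 'h \<Rightarrow> 'h"
  where "proj V x = (THE y. y \<in> V \<and> x - y \<in> ortho V)"

definition clinear_on :: "'h::complex_vector set \<Rightarrow> ('h \<Rightarrow> 'k::complex_vector) \<Rightarrow> bool"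
  where "clinear_on V f \<longleftrightarrow>
    (\<forall>x\<in>V. \<forall>y\<in>V. f (x + y) = f x + f y) \<and> (\<forall>c. \<forall>x\<in>V. f (scaleC c x) = scaleC c (f x))"

definition bounded_ops :: "'h::complex_normed_vector set \<Rightarrow> ('h \<Rightarrow> 'h) set"
  where "bounded_ops V =
    {T. T ` V \<subseteq> V \<and> clinear_on V T \<and> (\<exists>c. \<forall>x\<in>V. norm (T x) \<le> c * norm x)}"

text \<open>\<open>B\<close> is the adjoint of \<open>T : X \<rightarrow> Y\<close>. The inner products are explicit because one of the spaces
  may be a completed tensor product, which is a set and not a type.\<close>

definition is_adjoint :: "('x \<Rightarrow> 'x \<Rightarrow> complex) \<Rightarrow> 'x set \<Rightarrow> ('y \<Rightarrow> 'y \<Rightarrow> complex) \<Rightarrow> 'y set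
    \<Rightarrow> ('x \<Rightarrow> 'y) \<Rightarrow> ('y \<Rightarrow> 'x) \<Rightarrow> bool"
  where "is_adjoint ipX X ipY Y T B \<longleftrightarrow>
    T ` X \<subseteq> Y \<and> B ` Y \<subseteq> X \<and> (\<forall>x\<in>X. \<forall>y\<in>Y. ipX (B y) x = ipY y (T x))"

abbreviation is_adjoint_on :: "'h::chilbert_space set \<Rightarrow> ('h \<Rightarrow> 'h) \<Rightarrow> ('h \<Rightarrow> 'h) \<Rightarrow> bool"
  where "is_adjoint_on V \<equiv> is_adjoint cinner V cinner V"

section \<open>Representations\<close>

definition unital_star_rep :: "'h::chilbert_space set \<Rightarrow> ('a::cstar_algebra \<Rightarrow> 'h \<Rightarrow> 'h) \<Rightarrow> bool"
  where "unital_star_rep V \<sigma> \<longleftrightarrow>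
    (\<forall>a. \<sigma> a \<in> bounded_ops V) \<and>
    (\<forall>a b. \<forall>h\<in>V. \<sigma> (a + b) h = \<sigma> a h + \<sigma> b h) \<and>
    (\<forall>c a. \<forall>h\<in>V. \<sigma> (scaleC c a) h = scaleC c (\<sigma> a h)) \<and>
    (\<forall>a b. \<forall>h\<in>V. \<sigma> (a * b) h = \<sigma> a (\<sigma> b h)) \<and>
    (\<forall>h\<in>V. \<sigma> 1 h = h) \<and>
    (\<forall>a. is_adjoint_on V (\<sigma> a) (\<sigma> (star a)))"

definition completely_contractive ::
    "('a::cstar_algebra, 'e) correspondence \<Rightarrow> 'h::chilbert_space set \<Rightarrow> ('e \<Rightarrow> 'h \<Rightarrow> 'h) \<Rightarrow> bool"
  where "completely_contractive E V A \<longleftrightarrow>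
    (\<forall>n \<xi> h. (\<forall>j<n. h j \<in> V) \<longrightarrow>
      L2_set (\<lambda>i. norm (\<Sum>j<n. A (\<xi> i j) (h j))) {..<n}
        \<le> module_matrix_norm E n \<xi> * L2_set (\<lambda>j. norm (h j)) {..<n})"

definition corr_representation :: "('a::cstar_algebra, 'e::complex_banach) correspondence
    \<Rightarrow> 'h::chilbert_space set \<Rightarrow> ('e \<Rightarrow> 'h \<Rightarrow> 'h) \<Rightarrow> ('a \<Rightarrow> 'h \<Rightarrow> 'h) \<Rightarrow> bool"
  where "corr_representation E V A \<sigma> \<longleftrightarrow>
    closed_csubspace V \<and>
    (\<forall>\<xi>. A \<xi> \<in> bounded_ops V) \<and>
    (\<forall>\<xi> \<eta>. \<forall>h\<in>V. A (\<xi> + \<eta>) h = A \<xi> h + A \<eta> h) \<and>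
    (\<forall>c \<xi>. \<forall>h\<in>V. A (scaleC c \<xi>) h = scaleC c (A \<xi> h)) \<and>
    completely_contractive E V A \<and>
    unital_star_rep V \<sigma> \<and>
    (\<forall>a \<xi> b. \<forall>h\<in>V. A (lact E a (ract E \<xi> b)) h = \<sigma> a (A \<xi> (\<sigma> b h)))"

definition isometric :: "('a::cstar_algebra, 'e::complex_banach) correspondence
    \<Rightarrow> 'h::chilbert_space set \<Rightarrow> ('e \<Rightarrow> 'h \<Rightarrow> 'h) \<Rightarrow> ('a \<Rightarrow> 'h \<Rightarrow> 'h) \<Rightarrow> bool"
  where "isometric E V A \<sigma> \<longleftrightarrow>
    (\<forall>\<xi> \<eta>. \<exists>B. is_adjoint_on V (A \<xi>) B \<and> (\<forall>h\<in>V. B (A \<eta> h) = \<sigma> (mip E \<xi> \<eta>) h))"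

definition unitarily_equivalent ::
    "'h::chilbert_space set \<Rightarrow> ('e \<Rightarrow> 'h \<Rightarrow> 'h) \<Rightarrow> ('a \<Rightarrow> 'h \<Rightarrow> 'h)
    \<Rightarrow> 'k::chilbert_space set \<Rightarrow> ('e \<Rightarrow> 'k \<Rightarrow> 'k) \<Rightarrow> ('a \<Rightarrow> 'k \<Rightarrow> 'k) \<Rightarrow> bool"
  where "unitarily_equivalent V A \<sigma> W B \<tau> \<longleftrightarrow>
    (\<exists>U. bij_betw U V W \<and> clinear_on V U \<and>
      (\<forall>x\<in>V. \<forall>y\<in>V. cinner (U x) (U y) = cinner x y) \<and>
      (\<forall>\<xi>. \<forall>h\<in>V. U (A \<xi> h) = B \<xi> (U h)) \<and>
      (\<forall>a. \<forall>h\<in>V. U (\<sigma> a h) = \<tau> a (U h)))"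

section \<open>Tensor products\<close>

subsection \<open>Hausdorff completion of a positive semidefinite form\<close>

text \<open>The completion is the set of Cauchy sequences of formal linear combinations of elements of \<open>X\<close>,
  modulo sequences tending to \<open>0\<close>, for the semi-inner product with \<open>\<langle>x, y\<rangle> = K x y\<close> on generators. In the
  tensor products below the bilinearity relations are null vectors of this form, so that the
  completion of the formal linear combinations is that of the algebraic tensor product.\<close>

definition kform :: "('x \<Rightarrow> 'x \<Rightarrow> complex) \<Rightarrow> ('x \<Rightarrow>\<^sub>0 complex) \<Rightarrow> ('x \<Rightarrow>\<^sub>0 complex) \<Rightarrow> complex"
  where "kform K u v =
    (\<Sum>x\<in>Poly_Mapping.keys u. \<Sum>y\<in>Poly_Mapping.keys v. cnj (Poly_Mapping.lookup u x) * Poly_Mapping.lookup v y * K x y)"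

definition kseminorm :: "('x \<Rightarrow> 'x \<Rightarrow> complex) \<Rightarrow> ('x \<Rightarrow>\<^sub>0 complex) \<Rightarrow> real"
  where "kseminorm K u = sqrt (Re (kform K u u))"

definition kcauchy :: "('x \<Rightarrow> 'x \<Rightarrow> complex) \<Rightarrow> 'x set \<Rightarrow> (nat \<Rightarrow> 'x \<Rightarrow>\<^sub>0 complex) set"
  where "kcauchy K X = {s. (\<forall>n. Poly_Mapping.keys (s n) \<subseteq> X) \<and>
    (\<forall>e>0. \<exists>N. \<forall>m\<ge>N. \<forall>n\<ge>N. kseminorm K (s m - s n) < e)}"

definition kcompletion :: "('x \<Rightarrow> 'x \<Rightarrow> complex) \<Rightarrow> 'x set \<Rightarrow> (nat \<Rightarrow> 'x \<Rightarrow>\<^sub>0 complex) set set"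
  where "kcompletion K X = kcauchy K X //
    {(s, t). s \<in> kcauchy K X \<and> t \<in> kcauchy K X \<and> (\<lambda>n. kseminorm K (s n - t n)) \<longlonglongrightarrow> 0}"

definition kcompletion_ip :: "('x \<Rightarrow> 'x \<Rightarrow> complex)
    \<Rightarrow> (nat \<Rightarrow> 'x \<Rightarrow>\<^sub>0 complex) set \<Rightarrow> (nat \<Rightarrow> 'x \<Rightarrow>\<^sub>0 complex) set \<Rightarrow> complex"
  where "kcompletion_ip K p q = lim (\<lambda>n. kform K ((SOME s. s \<in> p) n) ((SOME t. t \<in> q) n))"

text \<open>The continuous linear extension to the completion of a map \<open>f\<close> given on generators.\<close>

definition kextend :: "('x \<Rightarrow> 'h::complex_normed_vector) \<Rightarrow> (nat \<Rightarrow> 'x \<Rightarrow>\<^sub>0 complex) set \<Rightarrow> 'h"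
  where "kextend f p =
    lim (\<lambda>n. let u = (SOME s. s \<in> p) n in \<Sum>x\<in>Poly_Mapping.keys u. scaleC (Poly_Mapping.lookup u x) (f x))"

subsection \<open>The spaces \<open>E\<^sup>n \<otimes>\<^sub>\<sigma> V\<close> and the maps out of them\<close>

text \<open>The list \<open>[\<xi>\<^sub>1, \<dots>, \<xi>\<^sub>n]\<close> stands for \<open>\<xi>\<^sub>1 \<otimes> \<dots> \<otimes> \<xi>\<^sub>n \<in> E\<^sup>n\<close>, and the inner product satisfies
  \<open>\<langle>\<xi> \<otimes> \<xi>', \<eta> \<otimes> \<eta>'\<rangle> = \<langle>\<xi>', \<langle>\<xi>, \<eta>\<rangle> \<cdot> \<eta>'\<rangle>\<close>; here \<open>elem_ip_lact E a \<xi>s \<eta>s\<close> is \<open>\<langle>\<xi>s, a \<cdot> \<eta>s\<rangle>\<close>.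
  The empty list is \<open>1 \<in> 'a = E\<^sup>0\<close>, which suffices for \<open>n = 0\<close> as \<open>a \<otimes> h = 1 \<otimes> \<sigma>(a)h\<close>.\<close>

fun elem_ip_lact :: "('a::cstar_algebra, 'e) correspondence \<Rightarrow> 'a \<Rightarrow> 'e list \<Rightarrow> 'e list \<Rightarrow> 'a"
  where
    "elem_ip_lact E a [] [] = a"
  | "elem_ip_lact E a (\<xi> # \<xi>s) (\<eta> # \<eta>s) = elem_ip_lact E (mip E \<xi> (lact E a \<eta>)) \<xi>s \<eta>s"
  | "elem_ip_lact E a _ _ = 0"

fun elem_ip :: "('a::cstar_algebra, 'e) correspondence \<Rightarrow> 'e list \<Rightarrow> 'e list \<Rightarrow> 'a"
  where
    "elem_ip E [] [] = 1"
  | "elem_ip E (\<xi> # \<xi>s) (\<eta> # \<eta>s) = elem_ip_lact E (mip E \<xi> \<eta>) \<xi>s \<eta>s"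
  | "elem_ip E _ _ = 0"

definition tensor_kernel :: "('a::cstar_algebra, 'e) correspondence \<Rightarrow> ('a \<Rightarrow> 'h \<Rightarrow> 'h)
    \<Rightarrow> 'e list \<times> 'h::chilbert_space \<Rightarrow> 'e list \<times> 'h \<Rightarrow> complex"
  where "tensor_kernel E \<sigma> = (\<lambda>(\<xi>s, h) (\<eta>s, k). cinner h (\<sigma> (elem_ip E \<xi>s \<eta>s) k))"

definition tensor :: "('a::cstar_algebra, 'e) correspondence \<Rightarrow> 'h::chilbert_space set
    \<Rightarrow> ('a \<Rightarrow> 'h \<Rightarrow> 'h) \<Rightarrow> nat \<Rightarrow> (nat \<Rightarrow> ('e list \<times> 'h) \<Rightarrow>\<^sub>0 complex) set set"
  where "tensor E V \<sigma> n = kcompletion (tensor_kernel E \<sigma>) ({\<xi>s. length \<xi>s = n} \<times> V)"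

definition tensor_ip :: "('a::cstar_algebra, 'e) correspondence \<Rightarrow> ('a \<Rightarrow> 'h \<Rightarrow> 'h)
    \<Rightarrow> (nat \<Rightarrow> ('e list \<times> 'h::chilbert_space) \<Rightarrow>\<^sub>0 complex) set
    \<Rightarrow> (nat \<Rightarrow> ('e list \<times> 'h) \<Rightarrow>\<^sub>0 complex) set \<Rightarrow> complex"
  where "tensor_ip E \<sigma> = kcompletion_ip (tensor_kernel E \<sigma>)"

text \<open>On \<open>tensor E V \<sigma> n\<close> this is the map sending \<open>\<xi>\<^sub>1 \<otimes> \<dots> \<otimes> \<xi>\<^sub>n \<otimes> h\<close> to
  \<open>A(\<xi>\<^sub>1) \<dots> A(\<xi>\<^sub>n)h\<close>.\<close>

definition tilde :: "('e \<Rightarrow> 'h \<Rightarrow> 'h) \<Rightarrow> (nat \<Rightarrow> ('e list \<times> 'h::chilbert_space) \<Rightarrow>\<^sub>0 complex) set \<Rightarrow> 'h"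
  where "tilde A = kextend (\<lambda>(\<xi>s, h). foldr A \<xi>s h)"

definition fully_coisometric :: "('a::cstar_algebra, 'e::complex_banach) correspondence
    \<Rightarrow> 'h::chilbert_space set \<Rightarrow> ('e \<Rightarrow> 'h \<Rightarrow> 'h) \<Rightarrow> ('a \<Rightarrow> 'h \<Rightarrow> 'h) \<Rightarrow> bool"
  where "fully_coisometric E V A \<sigma> \<longleftrightarrow>
    (\<exists>B. is_adjoint (tensor_ip E \<sigma>) (tensor E V \<sigma> 1) cinner V (tilde A) B \<and>
      (\<forall>h\<in>V. tilde A (B h) = h))"

section \<open>Dilations and finitely correlated representations\<close>

definition dilation :: "('a::cstar_algebra, 'e::complex_banach) correspondence
    \<Rightarrow> 'h::chilbert_space set \<Rightarrow> ('e \<Rightarrow> 'h \<Rightarrow> 'h) \<Rightarrow> ('a \<Rightarrow> 'h \<Rightarrow> 'h)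
    \<Rightarrow> ('e \<Rightarrow> 'h \<Rightarrow> 'h) \<Rightarrow> ('a \<Rightarrow> 'h \<Rightarrow> 'h) \<Rightarrow> bool"
  where "dilation E V A \<sigma> S \<rho> \<longleftrightarrow>
    corr_representation E V A \<sigma> \<and> corr_representation E UNIV S \<rho> \<and>
    (\<forall>a. \<rho> a ` V \<subseteq> V \<and> \<rho> a ` ortho V \<subseteq> ortho V) \<and>
    (\<forall>a. \<forall>h\<in>V. \<rho> a h = \<sigma> a h) \<and>
    (\<forall>\<xi>. S \<xi> ` ortho V \<subseteq> ortho V) \<and>
    (\<forall>\<xi>. \<forall>h\<in>V. proj V (S \<xi> h) = A \<xi> h)"

text \<open>The tensor product of \<open>E\<^sup>n\<close> with \<open>V\<close> is formed with the representation \<open>\<rho>\<close>, which agrees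
  on \<open>V\<close> with the dilated one.\<close>

definition minimal_isometric_dilation :: "('a::cstar_algebra, 'e::complex_banach) correspondence
    \<Rightarrow> 'h::chilbert_space set \<Rightarrow> ('e \<Rightarrow> 'h \<Rightarrow> 'h) \<Rightarrow> ('a \<Rightarrow> 'h \<Rightarrow> 'h)
    \<Rightarrow> ('e \<Rightarrow> 'h \<Rightarrow> 'h) \<Rightarrow> ('a \<Rightarrow> 'h \<Rightarrow> 'h) \<Rightarrow> bool"
  where "minimal_isometric_dilation E V A \<sigma> S \<rho> \<longleftrightarrow>
    dilation E V A \<sigma> S \<rho> \<and> isometric E UNIV S \<rho> \<and>
    closure (cspan (\<Union>n. tilde S ` tensor E V \<rho> n)) = UNIV"

definition finitely_correlated :: "('a::cstar_algebra, 'e::complex_banach) correspondence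
    \<Rightarrow> ('e \<Rightarrow> 'h::chilbert_space \<Rightarrow> 'h) \<Rightarrow> ('a \<Rightarrow> 'h \<Rightarrow> 'h) \<Rightarrow> bool"
  where "finitely_correlated E S \<rho> \<longleftrightarrow>
    (\<exists>V A \<sigma>. finite_dim V \<and> V \<noteq> {0} \<and> minimal_isometric_dilation E V A \<sigma> S \<rho>)"

section \<open>Minimal cyclic coinvariant subspaces\<close>

inductive_set generated_algebra ::
    "('e \<Rightarrow> 'h::chilbert_space \<Rightarrow> 'h) \<Rightarrow> ('a \<Rightarrow> 'h \<Rightarrow> 'h) \<Rightarrow> ('h \<Rightarrow> 'h) set"
  for S :: "'e \<Rightarrow> 'h \<Rightarrow> 'h" and \<rho> :: "'a \<Rightarrow> 'h \<Rightarrow> 'h"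
  where
    gen_id: "id \<in> generated_algebra S \<rho>"
  | gen_S: "S \<xi> \<in> generated_algebra S \<rho>"
  | gen_rho: "\<rho> a \<in> generated_algebra S \<rho>"
  | gen_add: "(\<lambda>h. T h + R h) \<in> generated_algebra S \<rho>"
    if "T \<in> generated_algebra S \<rho>" "R \<in> generated_algebra S \<rho>"
  | gen_scale: "(\<lambda>h. scaleC c (T h)) \<in> generated_algebra S \<rho>"
    if "T \<in> generated_algebra S \<rho>"
  | gen_comp: "T \<circ> R \<in> generated_algebra S \<rho>"
    if "T \<in> generated_algebra S \<rho>" "R \<in> generated_algebra S \<rho>"

text \<open>The weak operator topology on the bounded operators is the coarsest one making all matrix
  coefficients \<open>T \<mapsto> \<langle>h, T k\<rangle>\<close> continuous; \<^term>\<open>euclidean\<close> is the product topology on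
  functions of \<open>(h, k)\<close>.\<close>

definition weak_operator_topology :: "('h::chilbert_space \<Rightarrow> 'h) topology"
  where "weak_operator_topology =
    pullback_topology (bounded_ops UNIV) (\<lambda>T (h, k). cinner h (T k)) euclidean"

definition wot_algebra ::
    "('e \<Rightarrow> 'h::chilbert_space \<Rightarrow> 'h) \<Rightarrow> ('a \<Rightarrow> 'h \<Rightarrow> 'h) \<Rightarrow> ('h \<Rightarrow> 'h) set"
  where "wot_algebra S \<rho> = weak_operator_topology closure_of generated_algebra S \<rho>"

definition adjoints :: "('h::chilbert_space \<Rightarrow> 'h) set \<Rightarrow> ('h \<Rightarrow> 'h) set"
  where "adjoints M = {B. \<exists>T\<in>M. is_adjoint_on UNIV T B}"

definition coinvariant ::
    "('e \<Rightarrow> 'h::chilbert_space \<Rightarrow> 'h) \<Rightarrow> ('a \<Rightarrow> 'h \<Rightarrow> 'h) \<Rightarrow> 'h set \<Rightarrow> bool"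
  where "coinvariant S \<rho> V \<longleftrightarrow>
    closed_csubspace V \<and> (\<forall>B\<in>adjoints (wot_algebra S \<rho>). B ` V \<subseteq> V)"

definition cyclic ::
    "('e \<Rightarrow> 'h::chilbert_space \<Rightarrow> 'h) \<Rightarrow> ('a \<Rightarrow> 'h \<Rightarrow> 'h) \<Rightarrow> 'h set \<Rightarrow> bool"
  where "cyclic S \<rho> V \<longleftrightarrow> closure (cspan {T v |T v. T \<in> wot_algebra S \<rho> \<and> v \<in> V}) = UNIV"

definition minimal_cyclic_coinvariant ::
    "('e \<Rightarrow> 'h::chilbert_space \<Rightarrow> 'h) \<Rightarrow> ('a \<Rightarrow> 'h \<Rightarrow> 'h) \<Rightarrow> 'h set \<Rightarrow> bool"
  where "minimal_cyclic_coinvariant S \<rho> V \<longleftrightarrow>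
    coinvariant S \<rho> V \<and> cyclic S \<rho> V \<and>
    \<not> (\<exists>W. W \<subset> V \<and> coinvariant S \<rho> W \<and> cyclic S \<rho> W)"

definition compression :: "'h::chilbert_space set \<Rightarrow> ('e \<Rightarrow> 'h \<Rightarrow> 'h) \<Rightarrow> 'e \<Rightarrow> 'h \<Rightarrow> 'h"
  where "compression V S \<xi> = restrict (\<lambda>h. proj V (S \<xi> h)) V"

definition restriction :: "'h set \<Rightarrow> ('a \<Rightarrow> 'h \<Rightarrow> 'h) \<Rightarrow> 'a \<Rightarrow> 'h \<Rightarrow> 'h"
  where "restriction V \<sigma> a = restrict (\<sigma> a) V"

end

theory Submission
  imports Defs
begin

text \<open>
  Let \<open>S(\<xi>s)\<close> denote the product of the operators \<open>S \<xi>\<close> over a word \<open>\<xi>s\<close>. A coinvariant subspace \<open>V\<close> reduces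
  \<open>\<sigma>\<close> and has a complement invariant under \<open>S\<close>; it is cyclic exactly when the vectors \<open>S(\<xi>s)h\<close> with
  \<open>h \<in> V\<close> span a dense subspace (\<open>coinvariant_iff\<close>, \<open>cyclic_iff\<close>).

  The compression to such a subspace determines the representation. In \<open>\<langle>S(\<xi>s)h, S(\<eta>s)k\<rangle>\<close> letters cancel
  pairwise by \<open>S(\<xi>)\<^sup>* S(\<eta>) = \<sigma>(\<langle>\<xi>, \<eta>\<rangle>)\<close> until one word is empty, and \<open>\<langle>h, S(\<zeta>s)k\<rangle>\<close> depends only on the
  compression (\<open>word_gram_of_compression\<close>). A unitary between the compressions therefore preserves the
  Gram matrix of the word vectors and extends to a unitary between the Hilbert spaces
  (\<open>unitary_of_equal_gram\<close>).

  Conversely, a unitary equivalence of the representations maps cyclic coinvariant subspaces to cyclic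
  coinvariant subspaces, and so does its inverse. It maps one minimal subspace onto the other because a
  minimal cyclic coinvariant subspace is contained in every cyclic coinvariant subspace
  (\<open>minimal_cyclic_coinvariant_least\<close>). This is the heart of the matter, and it follows from the fact
  that \<open>V \<inter> W\<close> is cyclic whenever \<open>V\<close> and \<open>W\<close> are cyclic coinvariant subspaces and \<open>V\<close> is finite dimensional
  (\<open>cyclic_Int\<close>).

  To see the latter, use full coisometricity to approximate \<open>x \<in> W\<close> by a sum \<open>\<Sum> S(\<xi>s\<^sub>i)v\<^sub>i\<close> with words of
  one common length and \<open>v\<^sub>i \<in> V\<close>, and let \<open>w\<^sub>i\<close> be the component of \<open>v\<^sub>i\<close> orthogonal to \<open>V \<inter> W\<close>. Words of
  one length applied to \<open>W\<close> and to \<open>ortho W\<close> are orthogonal to each other, and \<open>x\<close> is orthogonal to the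
  latter, so \<open>\<Sum> S(\<xi>s\<^sub>i)(w\<^sub>i - P w\<^sub>i)\<close> is small, where \<open>P\<close> is the projection to \<open>W\<close>. By compactness of
  the unit sphere of \<open>V\<close>, \<open>P\<close> has norm \<open>c < 1\<close> on the vectors of \<open>V\<close> orthogonal to \<open>V \<inter> W\<close>. Since the projections
  commute with \<open>\<sigma>\<close>, this bound passes to sums of words (\<open>word_sum_norm_le\<close>), and \<open>\<Sum> S(\<xi>s\<^sub>i)w\<^sub>i\<close> must be
  small as well. Hence \<open>x\<close> is a limit of sums of words applied to \<open>V \<inter> W\<close>.
\<close>

section \<open>Hilbert spaces\<close>

lemma cinner_add_left: "cinner (x + y) z = cinner x z + cinner y (z::'h::chilbert_space)"
  by (metis cinner_add_right cinner_commute complex_cnj_add)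

lemma cinner_scaleC_left: "cinner (scaleC c x) y = cnj c * cinner x (y::'h::chilbert_space)"
  by (metis cinner_commute cinner_scaleC_right complex_cnj_mult)

lemma cinner_zero_left [simp]: "cinner 0 (y::'h::chilbert_space) = 0"
  using cinner_add_left[of 0 0 y] by simp

lemma cinner_zero_right [simp]: "cinner (y::'h::chilbert_space) 0 = 0"
  using cinner_add_right[of y 0 0] by simp

lemma cinner_diff_right: "cinner x (y - z) = cinner x y - cinner x (z::'h::chilbert_space)"
  using cinner_add_right[of x "y - z" z] by simp

lemma cinner_diff_left: "cinner (x - y) z = cinner x z - cinner y (z::'h::chilbert_space)"
  using cinner_add_left[of "x - y" y z] by simp

lemma cinner_self_eq_0 [simp]: "cinner x x = 0 \<longleftrightarrow> x = (0::'h::chilbert_space)"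
  by (simp add: cinner_norm)

lemma cinner_eq_0_commute: "cinner x y = 0 \<longleftrightarrow> cinner y (x::'h::chilbert_space) = 0"
  by (metis cinner_commute complex_cnj_zero_iff)

lemma cmod_cinner_self: "cmod (cinner x x) = (norm (x::'h::chilbert_space))\<^sup>2"
  by (simp add: cinner_norm norm_power)

text \<open>Both the Cauchy-Schwarz inequality and the orthogonality of a nearest point come from removing from
  \<open>z\<close> its component along \<open>v\<close>.\<close>

lemma norm_minus_component:
  fixes v z :: "'h::chilbert_space"
  assumes "v \<noteq> 0"
  shows "(norm (z - scaleC (cinner v z / (norm v)\<^sup>2) v))\<^sup>2 = (norm z)\<^sup>2 - (cmod (cinner v z))\<^sup>2 / (norm v)\<^sup>2"
proof -
  let ?c = "cinner v z / (norm v)\<^sup>2"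
  have [simp]: "complex_of_real (norm v) \<noteq> 0" using assms by simp
  have "complex_of_real ((norm (z - scaleC ?c v))\<^sup>2) = cinner (z - scaleC ?c v) (z - scaleC ?c v)"
    by (simp add: cinner_norm)
  also have "\<dots> = cinner z z - ?c * cinner z v - cnj ?c * cinner v z + cnj ?c * ?c * cinner v v"
    by (simp add: cinner_diff_left cinner_diff_right cinner_scaleC_left cinner_scaleC_right algebra_simps)
  also have "cinner z v = cnj (cinner v z)" by (rule cinner_commute)
  also have "cinner z z - ?c * cnj (cinner v z) - cnj ?c * cinner v z + cnj ?c * ?c * cinner v v
     = cinner z z - cnj (cinner v z) * cinner v z / (norm v)\<^sup>2"
    by (simp add: cinner_norm field_simps power2_eq_square)
  also have "\<dots> = complex_of_real ((norm z)\<^sup>2 - (cmod (cinner v z))\<^sup>2 / (norm v)\<^sup>2)"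
    by (simp add: cinner_norm of_real_divide mult.commute flip: complex_norm_square)
  finally show ?thesis by (simp only: of_real_eq_iff)
qed

lemma cauchy_schwarz: "cmod (cinner x y) \<le> norm x * norm (y::'h::chilbert_space)"
proof (cases "x = 0")
  case False
  have "0 \<le> (norm y)\<^sup>2 - (cmod (cinner x y))\<^sup>2 / (norm x)\<^sup>2"
    using norm_minus_component[OF False, of y] by (metis zero_le_power2)
  then have "(cmod (cinner x y))\<^sup>2 \<le> (norm x * norm y)\<^sup>2"
    using False by (simp add: field_simps power2_eq_square)
  then show ?thesis by (rule power2_le_imp_le) simp
qed simp

lemma bounded_bilinear_cinner: "bounded_bilinear (cinner :: 'h::chilbert_space \<Rightarrow> 'h \<Rightarrow> complex)"
proof
  show "\<exists>K. \<forall>a b. norm (cinner a (b::'h)) \<le> norm a * norm b * K"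
    by (rule exI[of _ 1]) (simp add: cauchy_schwarz)
qed (simp_all add: cinner_add_left cinner_add_right scaleR_scaleC cinner_scaleC_left
    cinner_scaleC_right scaleR_conv_of_real)

lemmas tendsto_cinner = bounded_bilinear.tendsto[OF bounded_bilinear_cinner]
lemmas continuous_on_cinner = bounded_bilinear.continuous_on[OF bounded_bilinear_cinner]
lemmas cinner_sum_left = bounded_bilinear.sum_left[OF bounded_bilinear_cinner]
lemmas cinner_sum_right = bounded_bilinear.sum_right[OF bounded_bilinear_cinner]

lemma tendsto_scaleC:
  assumes "(f \<longlongrightarrow> (x::'h::complex_normed_vector)) F"
  shows "((\<lambda>n. scaleC c (f n)) \<longlongrightarrow> scaleC c x) F"
proof -
  have "bounded_linear (scaleC c :: 'h \<Rightarrow> 'h)"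
    by (rule bounded_linear_intro[of _ "cmod c"])
      (simp_all add: scaleC_add_right scaleR_scaleC scaleC_scaleC norm_scaleC mult.commute)
  then show ?thesis using assms by (rule bounded_linear.tendsto)
qed

lemma norm_add_pythagoras:
  assumes "cinner x y = 0"
  shows "(norm (x + y))\<^sup>2 = (norm x)\<^sup>2 + (norm (y::'h::chilbert_space))\<^sup>2"
proof -
  have "complex_of_real ((norm (x + y))\<^sup>2) = complex_of_real ((norm x)\<^sup>2 + (norm y)\<^sup>2)"
    using assms cinner_eq_0_commute[of x y]
    by (simp add: cinner_norm[symmetric] cinner_add_left cinner_add_right del: of_real_power)
  then show ?thesis by (simp only: of_real_eq_iff)
qed

lemma parallelogram_law:
  "(norm (x + y))\<^sup>2 + (norm (x - y))\<^sup>2 = 2 * (norm x)\<^sup>2 + 2 * (norm (y::'h::chilbert_space))\<^sup>2"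
proof -
  have "complex_of_real ((norm (x + y))\<^sup>2 + (norm (x - y))\<^sup>2)
      = complex_of_real (2 * (norm x)\<^sup>2 + 2 * (norm y)\<^sup>2)"
    by (simp add: cinner_norm[symmetric] cinner_add_left cinner_add_right cinner_diff_left cinner_diff_right
        del: of_real_power)
  then show ?thesis by (simp only: of_real_eq_iff)
qed

lemma cspan_subset_iff: "csubspace M \<Longrightarrow> cspan A \<subseteq> M \<longleftrightarrow> A \<subseteq> M"
  using complex_vector.span_minimal complex_vector.span_superset by blast

lemma csubspace_cspan [simp]: "csubspace (cspan A)"
  by (rule complex_vector.subspace_span)

lemma csubspace_closure:
  fixes M :: "'h::complex_normed_vector set"
  assumes "csubspace M"
  shows "csubspace (closure M)"
proof (rule complex_vector.subspaceI)
  show "0 \<in> closure M" using complex_vector.subspace_0[OF assms] closure_subset by blast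
next
  fix x y assume "x \<in> closure M" "y \<in> closure M"
  then obtain f g where "\<forall>n. f n \<in> M" "f \<longlonglongrightarrow> x" "\<forall>n. g n \<in> M" "g \<longlonglongrightarrow> y"
    by (auto simp: closure_sequential)
  then show "x + y \<in> closure M"
    unfolding closure_sequential using complex_vector.subspace_add[OF assms]
    by (intro exI[of _ "\<lambda>n. f n + g n"]) (auto intro: tendsto_add)
next
  fix c x assume "x \<in> closure M"
  then obtain f where "\<forall>n. f n \<in> M" "f \<longlonglongrightarrow> x"
    by (auto simp: closure_sequential)
  then show "scaleC c x \<in> closure M"
    unfolding closure_sequential using complex_vector.subspace_scale[OF assms]
    by (intro exI[of _ "\<lambda>n. scaleC c (f n)"]) (auto intro: tendsto_scaleC)
qed

lemma closed_csubspace_closure_cspan [simp]: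
  "closed_csubspace (closure (cspan (A::'h::complex_normed_vector set)))"
  by (simp add: closed_csubspace_def csubspace_closure)

lemma closure_cspan_subset_iff:
  fixes M :: "'h::complex_normed_vector set"
  assumes "closed_csubspace M"
  shows "closure (cspan A) \<subseteq> M \<longleftrightarrow> A \<subseteq> M"
proof
  assume "A \<subseteq> M"
  then show "closure (cspan A) \<subseteq> M"
    using assms by (simp add: closed_csubspace_def closure_minimal cspan_subset_iff)
next
  show "closure (cspan A) \<subseteq> M \<Longrightarrow> A \<subseteq> M"
    using closure_subset complex_vector.span_superset by blast
qed

lemma superset_closure_cspan: "A \<subseteq> closure (cspan (A::'h::complex_normed_vector set))"
  using closure_subset complex_vector.span_superset by blast

lemma closed_csubspace_ortho [simp]: "closed_csubspace (ortho (V::'h::chilbert_space set))"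
  unfolding closed_csubspace_def
proof
  show "csubspace (ortho V)"
    by (rule complex_vector.subspaceI) (auto simp: ortho_def cinner_add_right cinner_scaleC_right)
  have "ortho V = (\<Inter>v\<in>V. {x. cinner v x = 0})" by (auto simp: ortho_def)
  moreover have "closed {x. cinner v x = 0}" for v :: 'h
    by (intro closed_Collect_eq continuous_on_cinner continuous_intros)
  ultimately show "closed (ortho V)" by auto
qed

lemma closed_csubspace_Int: "closed_csubspace V \<Longrightarrow> closed_csubspace W \<Longrightarrow> closed_csubspace (V \<inter> W)"
  by (simp add: closed_csubspace_def closed_Int complex_vector.subspace_inter)

lemma closed_csubspaceD:
  assumes "closed_csubspace V"
  shows "0 \<in> V" "x \<in> V \<Longrightarrow> y \<in> V \<Longrightarrow> x + y \<in> V" "x \<in> V \<Longrightarrow> y \<in> V \<Longrightarrow> x - y \<in> V"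
    "x \<in> V \<Longrightarrow> scaleC c x \<in> V"
  using assms by (auto simp: closed_csubspace_def complex_vector.subspace_0
      complex_vector.subspace_add complex_vector.subspace_diff complex_vector.subspace_scale)

text \<open>A minimising sequence for the distance from \<open>x\<close> to \<open>V\<close> is Cauchy by the parallelogram law.\<close>

lemma orthogonal_decomposition_exists:
  fixes V :: "'h::chilbert_space set"
  assumes V: "closed_csubspace V"
  shows "\<exists>y\<in>V. x - y \<in> ortho V"
proof -
  define d where "d = (INF y\<in>V. norm (x - y))"
  have bdd: "bdd_below ((\<lambda>y. norm (x - y)) ` V)" by (rule bdd_belowI[of _ 0]) auto
  have ne: "V \<noteq> {}" using closed_csubspaceD(1)[OF V] by blast
  have d_le: "d \<le> norm (x - y)" if "y \<in> V" for y
    unfolding d_def using bdd that by (rule cINF_lower)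
  have d0: "0 \<le> d" unfolding d_def by (rule cINF_greatest[OF ne]) simp
  have "\<exists>y\<in>V. norm (x - y) < d + 1 / Suc n" for n
  proof -
    have "d < d + 1 / Suc n" by simp
    then show ?thesis unfolding d_def using cINF_less_iff[OF ne bdd] by blast
  qed
  then obtain f where f: "\<And>n. f n \<in> V" and fd: "\<And>n. norm (x - f n) < d + 1 / Suc n"
    by metis
  have lim_d: "(\<lambda>n. norm (x - f n)) \<longlonglongrightarrow> d"
  proof (rule tendsto_sandwich[of "\<lambda>_. d" _ _ "\<lambda>n. d + 1 / Suc n"])
    show "(\<lambda>n. d + 1 / real (Suc n)) \<longlonglongrightarrow> d"
      using tendsto_add[OF tendsto_const[of d] LIMSEQ_inverse_real_of_nat]
      by (simp add: inverse_eq_divide)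
  qed (intro always_eventually allI d_le f less_imp_le[OF fd] tendsto_const)+
  have est: "(norm (f m - f n))\<^sup>2 \<le> 2 * (norm (x - f m))\<^sup>2 + 2 * (norm (x - f n))\<^sup>2 - 4 * d\<^sup>2" for m n
  proof -
    let ?y = "scaleC (1/2) (f m + f n)"
    have "?y \<in> V" using V f by (intro closed_csubspaceD) auto
    then have "d \<le> norm (x - ?y)" by (rule d_le)
    moreover have eq: "(x - f m) + (x - f n) = scaleC 2 (x - ?y)"
    proof -
      have "scaleC 2 (x - ?y) = scaleC 2 x - scaleC 2 ?y"
        by (rule complex_vector.scale_right_diff_distrib)
      moreover have "scaleC 2 ?y = f m + f n" by (simp add: scaleC_scaleC scaleC_one)
      moreover have "scaleC 2 x = x + x"
        using scaleC_add_left[of 1 1 x] by (simp add: scaleC_one)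
      ultimately show ?thesis by simp
    qed
    ultimately have "2 * d \<le> norm ((x - f m) + (x - f n))"
      by (simp add: eq norm_scaleC)
    then have "4 * d\<^sup>2 \<le> (norm ((x - f m) + (x - f n)))\<^sup>2"
      using power_mono[of "2 * d" "norm ((x - f m) + (x - f n))" 2] d0 by (simp add: power_mult_distrib)
    moreover have "norm ((x - f m) - (x - f n)) = norm (f m - f n)"
      by (simp add: norm_minus_commute)
    ultimately show ?thesis
      using parallelogram_law[of "x - f m" "x - f n"] by simp
  qed
  have "Cauchy f"
    unfolding Cauchy_def dist_norm
  proof (intro allI impI)
    fix e :: real assume e: "e > 0"
    have "(\<lambda>n. (norm (x - f n))\<^sup>2) \<longlonglongrightarrow> d\<^sup>2" by (intro tendsto_intros lim_d)
    then obtain N where N: "\<And>n. n \<ge> N \<Longrightarrow> \<bar>(norm (x - f n))\<^sup>2 - d\<^sup>2\<bar> < e\<^sup>2 / 4"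
      using e LIMSEQ_D[of "\<lambda>n. (norm (x - f n))\<^sup>2" "d\<^sup>2" "e\<^sup>2 / 4"] by auto
    show "\<exists>M. \<forall>m\<ge>M. \<forall>n\<ge>M. norm (f m - f n) < e"
    proof (intro exI allI impI)
      fix m n assume "m \<ge> N" "n \<ge> N"
      then have "(norm (f m - f n))\<^sup>2 < e\<^sup>2" using est[of m n] N[of m] N[of n] by linarith
      then show "norm (f m - f n) < e" using e by (simp add: power2_less_imp_less)
    qed
  qed
  then obtain y where y: "f \<longlonglongrightarrow> y" using Cauchy_convergent convergent_def by blast
  have yV: "y \<in> V" using V f y by (metis closed_csubspace_def closed_sequentially)
  have "(\<lambda>n. norm (x - f n)) \<longlonglongrightarrow> norm (x - y)" by (intro tendsto_intros y)
  then have d: "norm (x - y) = d" using lim_d LIMSEQ_unique by blast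
  have "cinner v (x - y) = 0" if v: "v \<in> V" for v
  proof (rule ccontr)
    assume nz: "cinner v (x - y) \<noteq> 0"
    then have v0: "v \<noteq> 0" by auto
    let ?w = "scaleC (cinner v (x - y) / (norm v)\<^sup>2) v"
    have "y + ?w \<in> V" using V v yV by (intro closed_csubspaceD) auto
    then have "d \<le> norm (x - y - ?w)" using d_le by (simp add: diff_diff_eq)
    then have "d\<^sup>2 \<le> (norm (x - y - ?w))\<^sup>2" using d0 by (intro power_mono)
    then have "(cmod (cinner v (x - y)))\<^sup>2 / (norm v)\<^sup>2 \<le> 0"
      using norm_minus_component[OF v0, of "x - y"] d by simp
    then show False using nz v0
      by (metis divide_pos_pos not_le zero_less_norm_iff zero_less_power)
  qed
  then show ?thesis using yV by (auto simp: ortho_def)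
qed

lemma ortho_Int_self: "y \<in> V \<Longrightarrow> y \<in> ortho V \<Longrightarrow> y = (0::'h::chilbert_space)"
  by (auto simp: ortho_def)

lemma proj_unique:
  fixes V :: "'h::chilbert_space set"
  assumes V: "closed_csubspace V" and "y \<in> V" "x - y \<in> ortho V"
  shows "proj V x = y"
  unfolding proj_def
proof (rule the_equality)
  fix z assume z: "z \<in> V \<and> x - z \<in> ortho V"
  have "(x - y) - (x - z) \<in> ortho V"
    using z assms(3) by (blast intro: closed_csubspaceD(3)[OF closed_csubspace_ortho])
  moreover have "z - y \<in> V" using z assms(2) by (blast intro: closed_csubspaceD(3)[OF V])
  ultimately have "z - y = 0" by (intro ortho_Int_self) (auto simp: algebra_simps)
  then show "z = y" by simp
qed (use assms in auto)

lemma
  fixes V :: "'h::chilbert_space set"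
  assumes V: "closed_csubspace V"
  shows proj_in: "proj V x \<in> V" and proj_ortho: "x - proj V x \<in> ortho V"
proof -
  obtain y where y: "y \<in> V" "x - y \<in> ortho V" using orthogonal_decomposition_exists[OF V] by blast
  then have "proj V x = y" by (rule proj_unique[OF V])
  then show "proj V x \<in> V" "x - proj V x \<in> ortho V" using y by auto
qed

lemma proj_eq_self: "closed_csubspace V \<Longrightarrow> x \<in> V \<Longrightarrow> proj V x = (x::'h::chilbert_space)"
  by (rule proj_unique) (auto simp: ortho_def)

lemma cinner_proj:
  fixes V :: "'h::chilbert_space set"
  assumes "closed_csubspace V" "v \<in> V"
  shows "cinner v (proj V x) = cinner v x"
  using proj_ortho[OF assms(1), of x] assms(2) by (simp add: ortho_def cinner_diff_right)

lemma proj_symmetric: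
  fixes V :: "'h::chilbert_space set"
  assumes "closed_csubspace V"
  shows "cinner (proj V x) y = cinner x (proj V y)"
proof -
  have "cinner (proj V x) y = cinner (proj V x) (proj V y)"
    by (simp add: cinner_proj[OF assms] proj_in[OF assms])
  also have "\<dots> = cnj (cinner (proj V y) x)"
    by (subst cinner_commute) (simp add: cinner_proj[OF assms] proj_in[OF assms])
  finally show ?thesis by (simp add: cinner_commute[of x])
qed

lemma norm_proj_pythagoras:
  fixes V :: "'h::chilbert_space set"
  assumes "closed_csubspace V"
  shows "(norm x)\<^sup>2 = (norm (proj V x))\<^sup>2 + (norm (x - proj V x))\<^sup>2"
  using norm_add_pythagoras[of "proj V x" "x - proj V x"] proj_in[OF assms, of x] proj_ortho[OF assms, of x]
  by (simp add: ortho_def)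

lemma norm_proj_le:
  fixes V :: "'h::chilbert_space set"
  assumes "closed_csubspace V"
  shows "norm (proj V x) \<le> norm x"
proof (rule power2_le_imp_le)
  show "(norm (proj V x))\<^sup>2 \<le> (norm x)\<^sup>2"
    unfolding norm_proj_pythagoras[OF assms, of x] by simp
qed simp

lemma proj_diff:
  fixes V :: "'h::chilbert_space set"
  assumes V: "closed_csubspace V"
  shows "proj V (x - y) = proj V x - proj V y"
proof (rule proj_unique[OF V])
  have "(x - proj V x) - (y - proj V y) \<in> ortho V"
    by (intro closed_csubspaceD(3)[OF closed_csubspace_ortho] proj_ortho[OF V])
  then show "x - y - (proj V x - proj V y) \<in> ortho V" by (simp add: algebra_simps)
qed (intro closed_csubspaceD(3)[OF V] proj_in[OF V])

lemma proj_scaleC: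
  fixes V :: "'h::chilbert_space set"
  assumes V: "closed_csubspace V"
  shows "proj V (scaleC c x) = scaleC c (proj V x)"
proof (rule proj_unique[OF V])
  have "scaleC c (x - proj V x) \<in> ortho V"
    by (intro closed_csubspaceD(4)[OF closed_csubspace_ortho] proj_ortho[OF V])
  then show "scaleC c x - scaleC c (proj V x) \<in> ortho V"
    by (simp add: complex_vector.scale_right_diff_distrib)
qed (intro closed_csubspaceD(4)[OF V] proj_in[OF V])

lemma continuous_on_proj: "closed_csubspace V \<Longrightarrow> continuous_on A (proj (V::'h::chilbert_space set))"
  unfolding continuous_on_iff dist_norm
  by (intro ballI allI impI exI conjI, assumption)
    (simp flip: proj_diff, rule order_le_less_trans[OF norm_proj_le])

lemma closed_csubspace_eq_UNIV:
  fixes M :: "'h::chilbert_space set"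
  assumes M: "closed_csubspace M" and "\<And>x. x \<in> ortho M \<Longrightarrow> x = 0"
  shows "M = UNIV"
proof -
  have "x \<in> M" for x
    using assms(2)[OF proj_ortho[OF M, of x]] proj_in[OF M, of x] by simp
  then show ?thesis by blast
qed

lemma ortho_ortho:
  fixes V :: "'h::chilbert_space set"
  assumes V: "closed_csubspace V" and x: "\<And>y. y \<in> ortho V \<Longrightarrow> cinner x y = 0"
  shows "x \<in> V"
proof -
  let ?z = "x - proj V x"
  have "cinner x ?z = 0" using x proj_ortho[OF V] by blast
  moreover have "cinner (proj V x) ?z = 0" using proj_in[OF V] proj_ortho[OF V] by (auto simp: ortho_def)
  ultimately have "cinner ?z ?z = 0" by (simp add: cinner_diff_left)
  then show ?thesis using proj_in[OF V, of x] by simp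
qed

lemma ortho_closure_cspan: "ortho (closure (cspan A)) = ortho (A::'h::chilbert_space set)"
proof
  show "ortho (closure (cspan A)) \<subseteq> ortho A"
    using superset_closure_cspan[of A] by (auto simp: ortho_def)
  show "ortho A \<subseteq> ortho (closure (cspan A))"
  proof
    fix x assume "x \<in> ortho A"
    then have "A \<subseteq> ortho {x}" by (auto simp: ortho_def cinner_eq_0_commute)
    then have "closure (cspan A) \<subseteq> ortho {x}" by (simp add: closure_cspan_subset_iff)
    then show "x \<in> ortho (closure (cspan A))" by (auto simp: ortho_def cinner_eq_0_commute)
  qed
qed

subsection \<open>Compactness in finite dimensions\<close>

text \<open>The induction splits off the component of a new spanning vector orthogonal to the span of the
  old ones, which makes its coefficient a continuous function of the vector.\<close>

lemma finite_cspan_compact: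
  fixes B :: "'h::chilbert_space set"
  assumes "finite B"
  shows "closed (cspan B) \<and> (\<forall>r. compact {x \<in> cspan B. norm x \<le> r})"
  using assms
proof (induction B)
  case empty
  have "{x \<in> {0}. norm x \<le> r} \<subseteq> {0::'h}" for r :: real by blast
  then have "finite {x \<in> {0::'h}. norm x \<le> r}" for r :: real by (rule finite_subset) simp
  then show ?case by (simp add: finite_imp_compact)
next
  case (insert b B)
  let ?M = "cspan B"
  have M: "closed_csubspace ?M" using insert.IH by (simp add: closed_csubspace_def)
  define e where "e = b - proj ?M b"
  have e: "e \<in> ortho ?M" unfolding e_def by (rule proj_ortho[OF M])
  have rep: "\<exists>c. \<exists>y\<in>?M. x = scaleC c e + y" if x: "x \<in> cspan (insert b B)" for x
  proof -
    obtain c where c: "x - scaleC c b \<in> ?M"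
      using x unfolding complex_vector.span_breakdown_eq by blast
    have "x = scaleC c e + (x - scaleC c b + scaleC c (proj ?M b))"
      unfolding e_def by (simp add: complex_vector.scale_right_diff_distrib)
    moreover have "x - scaleC c b + scaleC c (proj ?M b) \<in> ?M"
      by (intro closed_csubspaceD[OF M] c proj_in[OF M])
    ultimately show ?thesis by blast
  qed
  have bM: "b \<in> cspan (insert b B)" by (rule complex_vector.span_base) simp
  have sub: "?M \<subseteq> cspan (insert b B)" by (rule complex_vector.span_mono) auto
  have eN: "e \<in> cspan (insert b B)"
    unfolding e_def using bM sub proj_in[OF M] by (intro complex_vector.span_diff) auto
  show ?case
  proof (cases "e = 0")
    case True
    have "cspan (insert b B) \<subseteq> ?M"
    proof
      fix x assume "x \<in> cspan (insert b B)"
      then obtain c y where "y \<in> ?M" "x = scaleC c e + y" using rep by blast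
      then show "x \<in> ?M" using True by simp
    qed
    then have "cspan (insert b B) = ?M" using sub by blast
    then show ?thesis using insert.IH by simp
  next
    case False
    have coord: "norm y \<le> norm x" "cmod c * norm e \<le> norm x" if "y \<in> ?M" "x = scaleC c e + y" for x y c
    proof -
      have "cinner (scaleC c e) y = 0"
        using e that(1) cinner_eq_0_commute[of e y] by (simp add: cinner_scaleC_left ortho_def)
      then have "(norm x)\<^sup>2 = (norm (scaleC c e))\<^sup>2 + (norm y)\<^sup>2"
        using norm_add_pythagoras that(2) by blast
      then have "(norm y)\<^sup>2 \<le> (norm x)\<^sup>2" "(norm (scaleC c e))\<^sup>2 \<le> (norm x)\<^sup>2" by auto
      then show "norm y \<le> norm x" "cmod c * norm e \<le> norm x"
        by (auto intro: power2_le_imp_le simp flip: norm_scaleC)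
    qed
    have seq: "\<exists>l\<in>cspan (insert b B). \<exists>r. strict_mono r \<and> (f \<circ> r) \<longlonglongrightarrow> l"
      if f: "\<And>n. f n \<in> cspan (insert b B)" and K: "\<And>n. norm (f n) \<le> K" for f :: "nat \<Rightarrow> 'h" and K
    proof -
      obtain c y where cy: "\<And>n. y n \<in> ?M" "\<And>n. f n = scaleC (c n) e + y n"
        using rep[OF f] by metis
      have y: "\<And>n. norm (y n) \<le> K" and c: "\<And>n. cmod (c n) \<le> K / norm e"
        using coord[OF cy] K False by (auto simp: pos_le_divide_eq intro: order_trans)
      have "compact (cball (0::complex) (K / norm e))" by simp
      moreover have "\<forall>n. c n \<in> cball 0 (K / norm e)" using c by simp
      ultimately obtain a r where r: "strict_mono r" "(c \<circ> r) \<longlonglongrightarrow> a"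
        unfolding compact_def by blast
      have "compact {x \<in> ?M. norm x \<le> K}" using insert.IH by blast
      moreover have "\<forall>n. (y \<circ> r) n \<in> {x \<in> ?M. norm x \<le> K}" using cy y by simp
      ultimately obtain z q where q: "strict_mono q" "((y \<circ> r) \<circ> q) \<longlonglongrightarrow> z" and z: "z \<in> ?M"
        unfolding compact_def by blast
      have "(\<lambda>n. scaleC (c (r (q n))) e) \<longlonglongrightarrow> scaleC a e"
      proof (rule LIM_zero_cancel, rule tendsto_norm_zero_cancel)
        have "(\<lambda>n. cmod (c (r (q n)) - a) * norm e) \<longlonglongrightarrow> cmod (a - a) * norm e"
          using LIMSEQ_subseq_LIMSEQ[OF r(2) q(1)] by (intro tendsto_intros) (simp add: o_def)
        then show "(\<lambda>n. norm (scaleC (c (r (q n))) e - scaleC a e)) \<longlonglongrightarrow> 0"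
          by (simp add: norm_scaleC flip: complex_vector.scale_left_diff_distrib)
      qed
      moreover have "(\<lambda>n. y (r (q n))) \<longlonglongrightarrow> z" using q(2) by (simp add: o_def)
      ultimately have "(f \<circ> (r \<circ> q)) \<longlonglongrightarrow> scaleC a e + z"
        by (simp add: o_def cy(2) tendsto_add)
      moreover have "scaleC a e + z \<in> cspan (insert b B)"
        using z sub eN by (intro complex_vector.span_add complex_vector.span_scale) auto
      ultimately show ?thesis using r(1) q(1) strict_mono_o by blast
    qed
    have "closed (cspan (insert b B))"
      unfolding closed_sequential_limits
    proof (intro allI impI, elim conjE)
      fix f l assume f: "\<forall>n. f n \<in> cspan (insert b B)" and l: "f \<longlonglongrightarrow> l"
      have "Bseq f" by (rule convergent_imp_Bseq[OF convergentI[OF l]])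
      then obtain K where K: "\<forall>n. norm (f n) \<le> K" unfolding Bseq_def by blast
      obtain l' r where l': "l' \<in> cspan (insert b B)" "strict_mono r" "(f \<circ> r) \<longlonglongrightarrow> l'"
        using seq[of f K] f K by blast
      have "l' = l" by (rule LIMSEQ_unique[OF l'(3) LIMSEQ_subseq_LIMSEQ[OF l l'(2)]])
      then show "l \<in> cspan (insert b B)" using l'(1) by simp
    qed
    moreover have "compact {x \<in> cspan (insert b B). norm x \<le> K}" for K
      unfolding compact_def
    proof (intro allI impI)
      fix f :: "nat \<Rightarrow> 'h" assume f: "\<forall>n. f n \<in> {x \<in> cspan (insert b B). norm x \<le> K}"
      then obtain l r where l: "l \<in> cspan (insert b B)" "strict_mono r" "(f \<circ> r) \<longlonglongrightarrow> l"
        using seq[of f K] by blast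
      have "(\<lambda>n. norm ((f \<circ> r) n)) \<longlonglongrightarrow> norm l" by (intro tendsto_intros l)
      then have "norm l \<le> K" by (rule LIMSEQ_le_const2) (use f in auto)
      then show "\<exists>l\<in>{x \<in> cspan (insert b B). norm x \<le> K}. \<exists>r. strict_mono r \<and> (f \<circ> r) \<longlonglongrightarrow> l"
        using l by blast
    qed
    ultimately show ?thesis by blast
  qed
qed


text \<open>Compactness of the unit sphere of \<open>V\<close> turns the strict inequality \<open>norm (proj W v) < norm v\<close>
  into a uniform one.\<close>

lemma norm_proj_le_contraction:
  fixes V W :: "'h::chilbert_space set"
  assumes V: "closed_csubspace V" and W: "closed_csubspace W" and "finite B" "V \<subseteq> cspan B"
    and disj: "V \<inter> W \<subseteq> {0}"
  shows "\<exists>c. 0 \<le> c \<and> c < 1 \<and> (\<forall>v\<in>V. norm (proj W v) \<le> c * norm v)"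
proof -
  define K where "K = {v \<in> V. norm v = 1}"
  have "compact ({x \<in> cspan B. norm x \<le> 1} \<inter> (V \<inter> {v. norm v = 1}))"
    using finite_cspan_compact[OF assms(3)] V
    by (intro compact_Int_closed closed_Int closed_Collect_eq continuous_intros)
      (auto simp: closed_csubspace_def)
  also have "{x \<in> cspan B. norm x \<le> 1} \<inter> (V \<inter> {v. norm v = 1}) = K"
    using assms(4) by (auto simp: K_def)
  finally have K: "compact K" .
  have unit: "\<exists>u\<in>K. v = scaleC (norm v) u" if "v \<in> V" "v \<noteq> 0" for v
  proof
    let ?u = "scaleC (inverse (norm v)) v"
    show "?u \<in> K" using that closed_csubspaceD(4)[OF V] by (simp add: K_def norm_scaleC norm_inverse)
    show "v = scaleC (norm v) ?u" using that by (simp add: scaleC_scaleC scaleC_one)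
  qed
  show ?thesis
  proof (cases "K = {}")
    case True
    then have "v = 0" if "v \<in> V" for v using unit that by blast
    moreover have "proj W 0 = 0" by (rule proj_eq_self[OF W closed_csubspaceD(1)[OF W]])
    ultimately show ?thesis by (intro exI[of _ 0]) auto
  next
    case False
    have "continuous_on K (\<lambda>v. norm (proj W v))"
      by (intro continuous_on_norm continuous_on_proj[OF W])
    then obtain m where m: "m \<in> K" "\<And>u. u \<in> K \<Longrightarrow> norm (proj W u) \<le> norm (proj W m)"
      using continuous_attains_sup[OF K False] by blast
    have "m \<notin> W" using m(1) disj by (auto simp: K_def)
    then have "m - proj W m \<noteq> 0" using proj_in[OF W, of m] by auto
    then have "(norm (proj W m))\<^sup>2 < (norm m)\<^sup>2"
      unfolding norm_proj_pythagoras[OF W, of m] by simp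
    then have "norm (proj W m) < 1"
      using m(1) power2_less_imp_less[of "norm (proj W m)" 1] by (simp add: K_def)
    moreover have "norm (proj W v) \<le> norm (proj W m) * norm v" if v: "v \<in> V" for v
    proof (cases "v = 0")
      case True
      then show ?thesis using norm_proj_le[OF W, of 0] by simp
    next
      case False
      then obtain u where u: "u \<in> K" and vu: "v = scaleC (norm v) u" using unit v by blast
      have "norm (proj W v) = norm v * norm (proj W u)"
        by (subst vu) (simp add: proj_scaleC[OF W] norm_scaleC)
      also have "\<dots> \<le> norm v * norm (proj W m)" by (intro mult_left_mono m(2) u) simp
      finally show ?thesis by (simp add: mult.commute)
    qed
    ultimately show ?thesis by (intro exI[of _ "norm (proj W m)"]) auto
  qed
qed

section \<open>Isometric representations and their words\<close>

lemma bounded_ops_UNIV_I: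
  assumes "\<And>x y. f (x + y) = f x + f y" "\<And>c x. f (scaleC c x) = scaleC c (f x)"
    "\<And>x. norm (f x) \<le> c * norm x"
  shows "f \<in> bounded_ops UNIV"
  using assms by (auto simp: bounded_ops_def clinear_on_def)

lemma bounded_ops_UNIV_D:
  assumes "f \<in> bounded_ops UNIV"
  shows "f (x + y) = f x + f y" "f (scaleC c x) = scaleC c (f x)" "\<exists>c\<ge>0. \<forall>x. norm (f x) \<le> c * norm x"
proof -
  obtain c where c: "\<And>x. norm (f x) \<le> c * norm x"
    using assms by (auto simp: bounded_ops_def)
  have "norm (f x) \<le> max c 0 * norm x" for x
    using c[of x] mult_right_mono[of c "max c 0" "norm x"] by simp
  then show "\<exists>c\<ge>0. \<forall>x. norm (f x) \<le> c * norm x" by (intro exI[of _ "max c 0"]) auto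
qed (use assms in \<open>auto simp: bounded_ops_def clinear_on_def\<close>)

lemma bounded_linear_bounded_ops:
  assumes "f \<in> bounded_ops UNIV"
  shows "bounded_linear f"
proof -
  obtain c where "\<And>x. norm (f x) \<le> c * norm x" using bounded_ops_UNIV_D(3)[OF assms] by blast
  then show ?thesis
    by (intro bounded_linear_intro[of f c])
      (auto simp: scaleR_scaleC bounded_ops_UNIV_D(1,2)[OF assms] mult.commute)
qed

lemma id_bounded_ops: "id \<in> bounded_ops UNIV"
  by (rule bounded_ops_UNIV_I[of _ 1]) auto

lemma comp_bounded_ops:
  assumes f: "f \<in> bounded_ops UNIV" and g: "g \<in> bounded_ops UNIV"
  shows "f \<circ> g \<in> bounded_ops UNIV"
proof -
  obtain c where c: "c \<ge> 0" "\<And>x. norm (f x) \<le> c * norm x" using bounded_ops_UNIV_D(3)[OF f] by blast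
  obtain d where d: "\<And>x. norm (g x) \<le> d * norm x" using bounded_ops_UNIV_D(3)[OF g] by blast
  show ?thesis
  proof (rule bounded_ops_UNIV_I[of _ "c * d"])
    fix x
    have "norm (f (g x)) \<le> c * norm (g x)" by (rule c)
    also have "\<dots> \<le> c * (d * norm x)" by (intro mult_left_mono c d)
    finally show "norm ((f \<circ> g) x) \<le> c * d * norm x" by (simp add: mult.assoc)
  qed (simp_all add: bounded_ops_UNIV_D(1,2)[OF f] bounded_ops_UNIV_D(1,2)[OF g])
qed

lemma bounded_op_maps_closed_span:
  fixes f :: "'h::complex_normed_vector \<Rightarrow> 'h"
  assumes f: "f \<in> bounded_ops UNIV" and N: "closed_csubspace N" and A: "f ` A \<subseteq> N"
  shows "f ` closure (cspan A) \<subseteq> N"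
proof -
  have "f 0 = 0" using bounded_linear_bounded_ops[OF f] by (simp add: linear_simps)
  then have "csubspace (f -` N)"
    by (intro complex_vector.subspaceI)
      (auto simp: bounded_ops_UNIV_D(1,2)[OF f] closed_csubspaceD[OF N])
  moreover have "closed (f -` N)"
    using N linear_continuous_on[OF bounded_linear_bounded_ops[OF f]]
    by (auto simp: closed_csubspace_def intro: closed_vimage)
  ultimately have "closed_csubspace (f -` N)" by (simp add: closed_csubspace_def)
  then have "closure (cspan A) \<subseteq> f -` N" using A by (simp add: closure_cspan_subset_iff image_subset_iff_subset_vimage)
  then show ?thesis by blast
qed

lemma dense_cspan_iff:
  "closure (cspan A) = UNIV \<longleftrightarrow> (\<forall>x\<in>ortho A. x = (0::'h::chilbert_space))"
proof
  assume "closure (cspan A) = UNIV"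
  then have "ortho A = ortho UNIV" by (metis ortho_closure_cspan)
  then show "\<forall>x\<in>ortho A. x = 0" using ortho_Int_self[of _ UNIV] by auto
next
  assume "\<forall>x\<in>ortho A. x = 0"
  then show "closure (cspan A) = UNIV"
    by (intro closed_csubspace_eq_UNIV) (auto simp: ortho_closure_cspan)
qed

text \<open>By the Gram formula below, the closed span of these vectors is a copy of \<open>E\<^sup>n \<otimes>\<^sub>\<sigma> V\<close> when \<open>S\<close> is
  isometric and \<open>V\<close> reduces \<open>\<sigma>\<close>. They stand in for the completed tensor products.\<close>

definition word_vectors :: "('e \<Rightarrow> 'h \<Rightarrow> 'h) \<Rightarrow> 'h set \<Rightarrow> nat \<Rightarrow> 'h set"
  where "word_vectors S V n = {foldr S \<xi>s v |\<xi>s v. length \<xi>s = n \<and> v \<in> V}"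

lemma word_vectors_0: "word_vectors S V 0 = V"
  by (auto simp: word_vectors_def)

lemma word_vectors_Suc: "word_vectors S V (Suc n) = (\<Union>\<xi>. S \<xi> ` word_vectors S V n)"
  unfolding word_vectors_def
  by (auto simp: length_Suc_conv image_iff) (metis comp_apply foldr.simps(2) length_Cons)+

locale isometric_representation =
  fixes E :: "('a::cstar_algebra, 'e::complex_banach) correspondence"
    and S :: "'e \<Rightarrow> 'h::chilbert_space \<Rightarrow> 'h" and \<sigma> :: "'a \<Rightarrow> 'h \<Rightarrow> 'h"
  assumes correspondence: "cstar_correspondence E"
    and representation: "corr_representation E UNIV S \<sigma>"
    and isometric: "isometric E UNIV S \<sigma>"
begin

lemma S_bounded_ops: "S \<xi> \<in> bounded_ops UNIV"
  using representation by (simp add: corr_representation_def)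

lemma \<sigma>_bounded_ops: "\<sigma> a \<in> bounded_ops UNIV"
  using representation by (simp add: corr_representation_def unital_star_rep_def)

lemma word_bounded_ops: "foldr S \<xi>s \<in> bounded_ops UNIV"
proof (induction \<xi>s)
  case (Cons \<xi> \<xi>s)
  then show ?case using comp_bounded_ops[OF S_bounded_ops[of \<xi>]] by (simp add: o_def)
qed (use id_bounded_ops in \<open>simp add: id_def\<close>)

lemmas \<sigma>_linear = bounded_linear_bounded_ops[OF \<sigma>_bounded_ops]

lemma \<sigma>_star: "cinner (\<sigma> (star a) h) k = cinner h (\<sigma> a k)"
  using representation by (simp add: corr_representation_def unital_star_rep_def is_adjoint_def)

lemma \<sigma>_S: "\<sigma> a (S \<xi> h) = S (lact E a \<xi>) h"
  using representation cstar_correspondence.ract_one[OF correspondence]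
  unfolding corr_representation_def unital_star_rep_def by (metis UNIV_I)

lemma S_gram: "cinner (S \<xi> h) (S \<eta> k) = cinner h (\<sigma> (mip E \<xi> \<eta>) k)"
proof -
  obtain B where B: "is_adjoint_on UNIV (S \<xi>) B" "\<And>h. B (S \<eta> h) = \<sigma> (mip E \<xi> \<eta>) h"
    using isometric unfolding isometric_def by (metis UNIV_I)
  have "cinner (S \<eta> k) (S \<xi> h) = cinner (B (S \<eta> k)) h" using B(1) by (simp add: is_adjoint_def)
  then show ?thesis by (metis B(2) cinner_commute)
qed

lemma word_gram_lact:
  assumes "length \<xi>s = length \<eta>s"
  shows "cinner (foldr S \<xi>s h) (\<sigma> a (foldr S \<eta>s k)) = cinner h (\<sigma> (elem_ip_lact E a \<xi>s \<eta>s) k)"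
  using assms by (induction \<xi>s \<eta>s arbitrary: a rule: list_induct2) (simp_all add: \<sigma>_S S_gram)

text \<open>Letters cancel from the left by \<open>S(\<xi>)\<^sup>* S(\<eta>) = \<sigma>(\<langle>\<xi>, \<eta>\<rangle>)\<close>, and the coefficient
  produced is absorbed into the next letter of the second word.\<close>

lemma word_gram:
  assumes "length \<xi>s = length \<eta>s"
  shows "cinner (foldr S \<xi>s h) (foldr S \<eta>s k) = cinner h (\<sigma> (elem_ip E \<xi>s \<eta>s) k)"
proof (cases \<xi>s)
  case Nil
  have "\<sigma> 1 k = k" using representation by (simp add: corr_representation_def unital_star_rep_def)
  then show ?thesis using Nil assms by simp
next
  case (Cons \<xi> \<xi>s')
  then obtain \<eta> \<eta>s' where "\<eta>s = \<eta> # \<eta>s'" using assms by (metis length_Suc_conv)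
  then show ?thesis using Cons assms by (simp add: S_gram word_gram_lact)
qed

lemma word_sum_gram:
  assumes "\<And>i. i \<in> I \<Longrightarrow> length (\<xi>s i) = n" "\<And>j. j \<in> J \<Longrightarrow> length (\<eta>s j) = n"
  shows "cinner (\<Sum>i\<in>I. foldr S (\<xi>s i) (h i)) (\<Sum>j\<in>J. foldr S (\<eta>s j) (k j))
    = (\<Sum>i\<in>I. \<Sum>j\<in>J. cinner (h i) (\<sigma> (elem_ip E (\<xi>s i) (\<eta>s j)) (k j)))"
  using assms by (subst sum.swap) (simp add: cinner_sum_left cinner_sum_right word_gram)

subsection \<open>Coinvariant and cyclic subspaces\<close>

lemma generated_subset_bounded_ops: "generated_algebra S \<sigma> \<subseteq> bounded_ops UNIV"
proof
  fix T assume "T \<in> generated_algebra S \<sigma>"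
  then show "T \<in> bounded_ops UNIV"
  proof induction
    case (gen_add T R)
    obtain c where c: "\<And>x. norm (T x) \<le> c * norm x" using bounded_ops_UNIV_D(3)[OF gen_add.IH(1)] by blast
    obtain d where d: "\<And>x. norm (R x) \<le> d * norm x" using bounded_ops_UNIV_D(3)[OF gen_add.IH(2)] by blast
    show ?case
    proof (rule bounded_ops_UNIV_I[of _ "c + d"])
      show "norm (T x + R x) \<le> (c + d) * norm x" for x
        using norm_triangle_ineq[of "T x" "R x"] c[of x] d[of x] by (simp add: distrib_right)
    qed (simp_all add: gen_add.IH[THEN bounded_ops_UNIV_D(1)] gen_add.IH[THEN bounded_ops_UNIV_D(2)]
        scaleC_add_right)
  next
    case (gen_scale T c)
    obtain d where d: "\<And>x. norm (T x) \<le> d * norm x" using bounded_ops_UNIV_D(3)[OF gen_scale.IH] by blast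
    show ?case
    proof (rule bounded_ops_UNIV_I[of _ "cmod c * d"])
      show "norm (scaleC c (T x)) \<le> cmod c * d * norm x" for x
        using mult_left_mono[OF d[of x], of "cmod c"] by (simp add: norm_scaleC mult.assoc)
    qed (simp_all add: bounded_ops_UNIV_D(1,2)[OF gen_scale.IH] scaleC_add_right scaleC_scaleC mult.commute)
  qed (fact id_bounded_ops S_bounded_ops \<sigma>_bounded_ops | rule comp_bounded_ops, assumption+)+
qed

lemma generated_subset_wot_algebra: "generated_algebra S \<sigma> \<subseteq> wot_algebra S \<sigma>"
  unfolding wot_algebra_def
  by (rule closure_of_subset)
    (simp add: weak_operator_topology_def topspace_pullback_topology generated_subset_bounded_ops)

lemma word_in_generated: "foldr S \<xi>s \<in> generated_algebra S \<sigma>"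
proof (induction \<xi>s)
  case (Cons \<xi> \<xi>s)
  then show ?case using generated_algebra.gen_comp[OF generated_algebra.gen_S[of S \<xi>]] by (simp add: o_def)
qed (use generated_algebra.gen_id in \<open>simp add: id_def\<close>)

text \<open>The vanishing of a fixed matrix coefficient is a closed condition in the weak operator topology,
  so it can be checked on the generated algebra.\<close>

lemma wot_algebra_cinner_eq_0:
  assumes T: "T \<in> wot_algebra S \<sigma>" and gen: "\<And>R. R \<in> generated_algebra S \<sigma> \<Longrightarrow> cinner h (R k) = 0"
  shows "cinner h (T k) = 0"
proof -
  let ?W = "weak_operator_topology :: ('h \<Rightarrow> 'h) topology"
  let ?C = "{R \<in> bounded_ops UNIV. cinner h (R k) = 0}"
  have top: "topspace ?W = bounded_ops UNIV"
    by (simp add: weak_operator_topology_def topspace_pullback_topology)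
  have "open {g :: 'h \<times> 'h \<Rightarrow> complex. g (h, k) \<noteq> 0}"
    by (intro open_Collect_neq continuous_on_const continuous_on_product_coordinates)
  then have "openin ?W ((\<lambda>T (h, k). cinner h (T k)) -` {g. g (h, k) \<noteq> 0} \<inter> bounded_ops UNIV)"
    unfolding weak_operator_topology_def openin_pullback_topology by auto
  also have "(\<lambda>T (h, k). cinner h (T k)) -` {g. g (h, k) \<noteq> 0} \<inter> bounded_ops UNIV
      = topspace ?W - ?C" using top by auto
  finally have "closedin ?W ?C" by (auto simp: closedin_def top)
  moreover have "generated_algebra S \<sigma> \<subseteq> ?C" using gen generated_subset_bounded_ops by auto
  ultimately have "wot_algebra S \<sigma> \<subseteq> ?C" unfolding wot_algebra_def by (intro closure_of_minimal)
  then show ?thesis using T by auto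
qed

lemma \<sigma>_ortho:
  assumes "\<And>a. \<sigma> a ` V \<subseteq> V" and "x \<in> ortho V"
  shows "\<sigma> a x \<in> ortho V"
  unfolding ortho_def
proof (intro CollectI ballI)
  fix v assume "v \<in> V"
  then have "\<sigma> (star a) v \<in> V" using assms(1) by blast
  then show "cinner v (\<sigma> a x) = 0" using assms(2) by (simp add: ortho_def flip: \<sigma>_star)
qed

lemma \<sigma>_proj:
  assumes V: "closed_csubspace V" and inv: "\<And>a. \<sigma> a ` V \<subseteq> V"
  shows "proj V (\<sigma> a x) = \<sigma> a (proj V x)"
proof (rule proj_unique[OF V])
  show "\<sigma> a (proj V x) \<in> V" using inv proj_in[OF V] by blast
  have "\<sigma> a (x - proj V x) \<in> ortho V" by (rule \<sigma>_ortho[OF inv proj_ortho[OF V]])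
  then show "\<sigma> a x - \<sigma> a (proj V x) \<in> ortho V" by (simp add: linear_simps[OF \<sigma>_linear])
qed

text \<open>Passing to adjoints turns invariance of \<open>V\<close> into invariance of its complement, a condition on
  matrix coefficients that extends from the generators to the generated algebra and then to its
  closure. For the converse it matters that \<open>S \<xi>\<close> has an adjoint, which isometricity supplies, and
  that the generators \<open>\<sigma> a\<close> are closed under adjoints.\<close>

lemma coinvariant_iff:
  "coinvariant S \<sigma> V \<longleftrightarrow>
    closed_csubspace V \<and> (\<forall>a. \<sigma> a ` V \<subseteq> V) \<and> (\<forall>\<xi>. S \<xi> ` ortho V \<subseteq> ortho V)"
proof
  assume co: "coinvariant S \<sigma> V"
  have adj: "B v \<in> V" if "T \<in> generated_algebra S \<sigma>" "is_adjoint_on UNIV T B" "v \<in> V" for T B v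
    using co that generated_subset_wot_algebra unfolding coinvariant_def adjoints_def by blast
  show "closed_csubspace V \<and> (\<forall>a. \<sigma> a ` V \<subseteq> V) \<and> (\<forall>\<xi>. S \<xi> ` ortho V \<subseteq> ortho V)"
  proof (intro conjI allI image_subsetI)
    show "closed_csubspace V" using co by (simp add: coinvariant_def)
    show "\<sigma> a v \<in> V" if "v \<in> V" for a v
      by (rule adj[OF generated_algebra.gen_rho[of \<sigma> "star a"] _ that])
        (use \<sigma>_star[of "star a"] in \<open>simp add: is_adjoint_def star_star\<close>)
    fix \<xi> x assume x: "x \<in> ortho V"
    obtain B where B: "is_adjoint_on UNIV (S \<xi>) B" using isometric unfolding isometric_def by blast
    have "cinner v (S \<xi> x) = 0" if "v \<in> V" for v
    proof -
      have "B v \<in> V" by (rule adj[OF generated_algebra.gen_S B that])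
      moreover have "cinner v (S \<xi> x) = cinner (B v) x" using B by (simp add: is_adjoint_def)
      ultimately show ?thesis using x by (simp add: ortho_def)
    qed
    then show "S \<xi> x \<in> ortho V" by (simp add: ortho_def)
  qed
next
  assume "closed_csubspace V \<and> (\<forall>a. \<sigma> a ` V \<subseteq> V) \<and> (\<forall>\<xi>. S \<xi> ` ortho V \<subseteq> ortho V)"
  then have V: "closed_csubspace V" and inv: "\<And>a. \<sigma> a ` V \<subseteq> V"
    and S: "\<And>\<xi> x. x \<in> ortho V \<Longrightarrow> S \<xi> x \<in> ortho V" by (auto simp: image_subset_iff)
  have gen: "\<forall>x\<in>ortho V. R x \<in> ortho V" if "R \<in> generated_algebra S \<sigma>" for R
    using that
    by induction (auto simp: S \<sigma>_ortho[OF inv] closed_csubspaceD[OF closed_csubspace_ortho])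
  have "B v \<in> V" if T: "T \<in> wot_algebra S \<sigma>" and B: "is_adjoint_on UNIV T B" and v: "v \<in> V" for T B v
  proof (rule ortho_ortho[OF V])
    fix y assume y: "y \<in> ortho V"
    have "cinner v (T y) = 0"
      by (rule wot_algebra_cinner_eq_0[OF T]) (use gen y v in \<open>auto simp: ortho_def\<close>)
    then show "cinner (B v) y = 0" using B by (simp add: is_adjoint_def)
  qed
  then show "coinvariant S \<sigma> V" using V by (auto simp: coinvariant_def adjoints_def)
qed

lemma coinvariantD:
  assumes "coinvariant S \<sigma> V"
  shows "closed_csubspace V" "\<sigma> a ` V \<subseteq> V" "x \<in> V \<Longrightarrow> \<sigma> a x \<in> V"
    "x \<in> ortho V \<Longrightarrow> S \<xi> x \<in> ortho V" "x \<in> ortho V \<Longrightarrow> foldr S \<xi>s x \<in> ortho V"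
proof -
  show "closed_csubspace V" "\<sigma> a ` V \<subseteq> V" "x \<in> V \<Longrightarrow> \<sigma> a x \<in> V"
    using assms by (auto simp: coinvariant_iff)
  show S: "x \<in> ortho V \<Longrightarrow> S \<xi> x \<in> ortho V" for x \<xi>
    using assms by (auto simp: coinvariant_iff image_subset_iff)
  show "x \<in> ortho V \<Longrightarrow> foldr S \<xi>s x \<in> ortho V" by (induction \<xi>s) (auto simp: S)
qed

lemma S_maps_word_span:
  "S \<xi> ` closure (cspan (\<Union>n. word_vectors S V n)) \<subseteq> closure (cspan (\<Union>n. word_vectors S V n))"
proof (rule bounded_op_maps_closed_span[OF S_bounded_ops])
  let ?A = "\<Union>n. word_vectors S V n"
  have "S \<xi> ` ?A \<subseteq> ?A" using word_vectors_Suc[of S V] by blast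
  then show "S \<xi> ` ?A \<subseteq> closure (cspan ?A)" using superset_closure_cspan[of ?A] by blast
qed simp

text \<open>A vector orthogonal to all words applied to \<open>V\<close> is orthogonal to the images of \<open>V\<close> under the generated
  algebra, because the closed span of these words is invariant under the generators, and hence to
  the images under the closure of the algebra.\<close>

lemma cyclic_iff:
  assumes inv: "\<And>a. \<sigma> a ` V \<subseteq> V"
  shows "cyclic S \<sigma> V \<longleftrightarrow> closure (cspan (\<Union>n. word_vectors S V n)) = UNIV"
proof -
  let ?A = "\<Union>n. word_vectors S V n"
  let ?M = "closure (cspan ?A)"
  let ?T = "{T v |T v. T \<in> wot_algebra S \<sigma> \<and> v \<in> V}"
  note S = S_maps_word_span[of _ V]
  have s: "\<sigma> a ` ?M \<subseteq> ?M" for a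
  proof (rule bounded_op_maps_closed_span[OF \<sigma>_bounded_ops])
    have "\<sigma> a x \<in> word_vectors S V n" if "x \<in> word_vectors S V n" for x n
      using that inv by (cases n) (auto simp: word_vectors_0 word_vectors_Suc \<sigma>_S, blast)
    then show "\<sigma> a ` ?A \<subseteq> ?M" using superset_closure_cspan[of ?A] by blast
  qed simp
  have gen: "\<forall>x\<in>?M. R x \<in> ?M" if "R \<in> generated_algebra S \<sigma>" for R
    using that
  proof induction
    case (gen_S \<xi>) then show ?case using S by blast
  next
    case (gen_rho a) then show ?case using s by blast
  qed (auto simp: closed_csubspaceD[OF closed_csubspace_closure_cspan])
  have "V \<subseteq> ?M" using superset_closure_cspan[of ?A] word_vectors_0[of S V] by blast
  have "cinner (T v) x = 0" if x: "x \<in> ortho ?M" and "T \<in> wot_algebra S \<sigma>" "v \<in> V" for T v x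
  proof -
    have "cinner x (T v) = 0"
    proof (rule wot_algebra_cinner_eq_0[OF that(2)])
      fix R assume "R \<in> generated_algebra S \<sigma>"
      then have "R v \<in> ?M" using gen \<open>V \<subseteq> ?M\<close> that(3) by blast
      then have "cinner (R v) x = 0" using x unfolding ortho_def by blast
      then show "cinner x (R v) = 0" by (subst cinner_eq_0_commute)
    qed
    then show ?thesis by (subst cinner_eq_0_commute)
  qed
  then have "ortho ?M \<subseteq> ortho ?T" unfolding ortho_def by blast
  moreover have "?A \<subseteq> ?T"
    using word_in_generated generated_subset_wot_algebra by (auto simp: word_vectors_def)
  then have "ortho ?T \<subseteq> ortho ?A" by (auto simp: ortho_def)
  ultimately have "ortho ?T = ortho ?A" by (simp add: ortho_closure_cspan)
  then show ?thesis by (simp add: cyclic_def dense_cspan_iff)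
qed

subsection \<open>Tensor products inside the Hilbert space\<close>

text \<open>By the Gram formula the linear map \<open>L\<close> that evaluates formal combinations of words is isometric for
  the seminorm of the tensor product. It therefore maps Cauchy sequences to Cauchy sequences, so that
  the limit defining \<open>tilde S p\<close> exists.\<close>

lemma tilde_in_closure:
  assumes p: "p \<in> tensor E V \<sigma> n"
  shows "tilde S p \<in> closure (cspan (word_vectors S V n))"
proof -
  let ?K = "tensor_kernel E \<sigma>" and ?X = "{\<xi>s. length \<xi>s = n} \<times> V"
  let ?f = "\<lambda>(\<xi>s, h). foldr S \<xi>s h"
  define L where "L u = (\<Sum>x\<in>Poly_Mapping.keys u. scaleC (Poly_Mapping.lookup u x) (?f x))" for u
  have L_superset: "L u = (\<Sum>x\<in>A. scaleC (Poly_Mapping.lookup u x) (?f x))"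
    if "finite A" "Poly_Mapping.keys u \<subseteq> A" for u A
    unfolding L_def using that by (intro sum.mono_neutral_left) (auto simp: in_keys_iff)
  have L_diff: "L (u - v) = L u - L v" for u v
  proof -
    let ?A = "Poly_Mapping.keys u \<union> Poly_Mapping.keys v"
    have "Poly_Mapping.keys (u - v) \<subseteq> ?A" by (rule keys_diff)
    then show ?thesis
      by (simp add: L_superset[of ?A] lookup_minus complex_vector.scale_left_diff_distrib sum_subtractf)
  qed
  have K: "?K x y = cinner (?f x) (?f y)" if "x \<in> ?X" "y \<in> ?X" for x y
    using that by (auto simp: tensor_kernel_def word_gram)
  have seminorm: "kseminorm ?K u = norm (L u)" if u: "Poly_Mapping.keys u \<subseteq> ?X" for u
  proof -
    have "kform ?K u u = (\<Sum>x\<in>Poly_Mapping.keys u. \<Sum>y\<in>Poly_Mapping.keys u.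
        cnj (Poly_Mapping.lookup u x) * Poly_Mapping.lookup u y * cinner (?f x) (?f y))"
      unfolding kform_def
    proof (intro sum.cong refl)
      fix x y assume "x \<in> Poly_Mapping.keys u" "y \<in> Poly_Mapping.keys u"
      then have "x \<in> ?X" "y \<in> ?X" using u by blast+
      then show "cnj (Poly_Mapping.lookup u x) * Poly_Mapping.lookup u y * ?K x y
          = cnj (Poly_Mapping.lookup u x) * Poly_Mapping.lookup u y * cinner (?f x) (?f y)"
        by (simp only: K)
    qed
    also have "\<dots> = (\<Sum>y\<in>Poly_Mapping.keys u. \<Sum>x\<in>Poly_Mapping.keys u.
        cnj (Poly_Mapping.lookup u x) * Poly_Mapping.lookup u y * cinner (?f x) (?f y))"
      by (rule sum.swap)
    also have "\<dots> = cinner (L u) (L u)"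
      unfolding L_def
      by (simp add: cinner_sum_left cinner_sum_right cinner_scaleC_left cinner_scaleC_right sum_distrib_left mult_ac)
    finally show ?thesis by (simp add: kseminorm_def cinner_norm)
  qed
  obtain s where s: "s \<in> kcauchy ?K ?X"
    and ps: "p = {(s, t). s \<in> kcauchy ?K ?X \<and> t \<in> kcauchy ?K ?X
      \<and> (\<lambda>n. kseminorm ?K (s n - t n)) \<longlonglongrightarrow> 0} `` {s}"
    using p unfolding tensor_def kcompletion_def by (rule quotientE)
  have "s \<in> p" using s by (simp add: ps kseminorm_def kform_def)
  then have "(SOME t. t \<in> p) \<in> p" by (rule someI[of "\<lambda>t. t \<in> p"])
  then obtain t where t: "t = (SOME t. t \<in> p)" and tC: "t \<in> kcauchy ?K ?X" by (auto simp: ps)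
  have tX: "Poly_Mapping.keys (t m) \<subseteq> ?X" for m using tC unfolding kcauchy_def by blast
  have diff: "kseminorm ?K (t i - t j) = norm (L (t i) - L (t j))" for i j
  proof -
    have "Poly_Mapping.keys (t i - t j) \<subseteq> ?X" using keys_diff[of "t i" "t j"] tX by blast
    then show ?thesis by (simp add: seminorm L_diff)
  qed
  have "Cauchy (\<lambda>m. L (t m))"
    using tC unfolding kcauchy_def Cauchy_def dist_norm diff[symmetric] by blast
  then have "(\<lambda>m. L (t m)) \<longlonglongrightarrow> lim (\<lambda>m. L (t m))"
    by (simp add: Cauchy_convergent convergent_LIMSEQ_iff[symmetric])
  moreover have "lim (\<lambda>m. L (t m)) = tilde S p"
    unfolding tilde_def kextend_def L_def Let_def t ..
  moreover have "L (t m) \<in> cspan (word_vectors S V n)" for m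
    unfolding L_def
  proof (rule complex_vector.span_sum, rule complex_vector.span_scale, rule complex_vector.span_base)
    fix x assume "x \<in> Poly_Mapping.keys (t m)"
    then have "x \<in> ?X" using tX by blast
    then show "?f x \<in> word_vectors S V n" by (auto simp: word_vectors_def)
  qed
  ultimately show ?thesis unfolding closure_sequential by metis
qed

lemma fully_coisometric_dense:
  assumes "fully_coisometric E UNIV S \<sigma>"
  shows "closure (cspan (word_vectors S UNIV 1)) = UNIV"
proof -
  obtain B where "\<And>h. B h \<in> tensor E UNIV \<sigma> 1" "\<And>h. tilde S (B h) = h"
    using assms by (auto simp: fully_coisometric_def is_adjoint_def image_subset_iff)
  then have "h \<in> closure (cspan (word_vectors S UNIV 1))" for h
    using tilde_in_closure[of "B h" UNIV 1] by simp
  then show ?thesis by blast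
qed

text \<open>The subspace whose dilation is \<open>S\<close> is coinvariant by the definition of a dilation, and minimality
  of the dilation says that it is cyclic.\<close>

lemma finitely_correlated_cyclic_coinvariant:
  assumes "finitely_correlated E S \<sigma>"
  obtains V where "finite_dim V" "coinvariant S \<sigma> V" "cyclic S \<sigma> V"
proof -
  obtain V A \<rho> where fin: "finite_dim V" and dil: "dilation E V A \<rho> S \<sigma>"
    and dense: "closure (cspan (\<Union>n. tilde S ` tensor E V \<sigma> n)) = UNIV"
    using assms by (auto simp: finitely_correlated_def minimal_isometric_dilation_def)
  have co: "coinvariant S \<sigma> V"
    using dil unfolding coinvariant_iff dilation_def corr_representation_def by blast
  let ?M = "closure (cspan (\<Union>n. word_vectors S V n))"
  have "closure (cspan (word_vectors S V n)) \<subseteq> ?M" for n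
    by (intro closure_mono complex_vector.span_mono) blast
  then have "(\<Union>n. tilde S ` tensor E V \<sigma> n) \<subseteq> ?M" using tilde_in_closure by blast
  then have "closure (cspan (\<Union>n. tilde S ` tensor E V \<sigma> n)) \<subseteq> ?M"
    by (simp add: closure_cspan_subset_iff)
  then have "cyclic S \<sigma> V" using dense cyclic_iff[OF coinvariantD(2)[OF co]] by auto
  then show thesis using that fin co by blast
qed

subsection \<open>Words of a common length\<close>

text \<open>Let \<open>r\<close> be the part of \<open>v \<in> V\<close> orthogonal to all \<open>S \<xi> w\<close> with \<open>w \<in> V\<close>. It is also orthogonal to all
  \<open>S \<xi> w\<close> with \<open>w \<in> ortho V\<close>: \<open>v\<close> is so because \<open>ortho V\<close> is invariant, and \<open>v - r\<close> is so by the Gram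
  formula, as \<open>\<sigma>\<close> preserves \<open>V\<close>. By density \<open>r = 0\<close>.\<close>

lemma coinvariant_subset_longer_words:
  assumes dense: "closure (cspan (word_vectors S UNIV 1)) = UNIV" and co: "coinvariant S \<sigma> V"
  shows "V \<subseteq> closure (cspan (word_vectors S V 1))"
proof
  fix v assume v: "v \<in> V"
  let ?M = "closure (cspan (word_vectors S V 1))"
  note V = coinvariantD(1)[OF co]
  have M: "closed_csubspace ?M" by simp
  have SM: "S \<xi> w \<in> ?M" if "w \<in> V" for \<xi> w
    using superset_closure_cspan[of "word_vectors S V 1"] that
    by (auto simp: word_vectors_Suc word_vectors_0)
  define r where "r = v - proj ?M v"
  have r: "r \<in> ortho ?M" unfolding r_def by (rule proj_ortho[OF M])
  have "cinner (S \<xi> h) r = 0" for \<xi> h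
  proof -
    let ?w = "proj V h"
    have w: "?w \<in> V" "h - ?w \<in> ortho V" using proj_in[OF V] proj_ortho[OF V] by auto
    have "cinner (S \<xi> (h - ?w)) v = 0"
      using coinvariantD(4)[OF co w(2)] v by (simp add: ortho_def cinner_eq_0_commute)
    moreover have "cinner (S \<xi> (h - ?w)) (proj ?M v) = 0"
    proof -
      have "word_vectors S V 1 \<subseteq> ortho {S \<xi> (h - ?w)}"
      proof
        fix y assume "y \<in> word_vectors S V 1"
        then obtain \<eta> k where y: "y = S \<eta> k" "k \<in> V" by (auto simp: word_vectors_Suc word_vectors_0)
        have "\<sigma> (mip E \<xi> \<eta>) k \<in> V" by (rule coinvariantD(3)[OF co y(2)])
        then have "cinner (\<sigma> (mip E \<xi> \<eta>) k) (h - ?w) = 0" using w(2) by (simp add: ortho_def)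
        then have "cinner (h - ?w) (\<sigma> (mip E \<xi> \<eta>) k) = 0" by (subst cinner_eq_0_commute)
        then show "y \<in> ortho {S \<xi> (h - ?w)}" by (simp add: ortho_def y(1) S_gram)
      qed
      then have "?M \<subseteq> ortho {S \<xi> (h - ?w)}" by (simp add: closure_cspan_subset_iff)
      then show ?thesis using proj_in[OF M, of v] by (auto simp: ortho_def)
    qed
    ultimately have "cinner (S \<xi> (h - ?w)) r = 0" by (simp add: r_def cinner_diff_right)
    moreover have "cinner (S \<xi> ?w) r = 0" using r SM[OF w(1)] by (simp add: ortho_def)
    moreover have "S \<xi> h = S \<xi> ?w + S \<xi> (h - ?w)"
      by (simp flip: bounded_ops_UNIV_D(1)[OF S_bounded_ops])
    ultimately show ?thesis by (simp add: cinner_add_left)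
  qed
  then have "r \<in> ortho (word_vectors S UNIV 1)"
    by (auto simp: word_vectors_Suc word_vectors_0 ortho_def)
  then have "r = 0" using dense by (auto simp: dense_cspan_iff)
  then show "v \<in> ?M" using proj_in[OF M, of v] by (simp add: r_def)
qed

text \<open>Full coisometricity makes the closed spans of the words of length \<open>n\<close> applied to \<open>V\<close>
  increase with \<open>n\<close>, so that finitely many words can be replaced by words of one length.\<close>

lemma approximation_by_words_of_common_length:
  assumes coiso: "closure (cspan (word_vectors S UNIV 1)) = UNIV"
    and co: "coinvariant S \<sigma> V" and cyc: "cyclic S \<sigma> V" and e: "e > 0"
  obtains n y where "y \<in> cspan (word_vectors S V n)" "norm (x - y) < e"
proof -
  define H where "H n = closure (cspan (word_vectors S V n))" for n
  have H: "closed_csubspace (H n)" for n by (simp add: H_def)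
  have "H n \<subseteq> H (Suc n)" for n
  proof -
    have "word_vectors S V n \<subseteq> H (Suc n)"
    proof
      fix x assume "x \<in> word_vectors S V n"
      then obtain \<xi>s v where x: "x = foldr S \<xi>s v" "length \<xi>s = n" "v \<in> V" by (auto simp: word_vectors_def)
      have "foldr S \<xi>s ` closure (cspan (word_vectors S V 1)) \<subseteq> H (Suc n)"
      proof (rule bounded_op_maps_closed_span[OF word_bounded_ops H])
        have "foldr S \<xi>s (foldr S \<eta>s w) = foldr S (\<xi>s @ \<eta>s) w" for \<eta>s w by simp
        then have "foldr S \<xi>s ` word_vectors S V 1 \<subseteq> word_vectors S V (Suc n)"
          using x(2) unfolding word_vectors_def by (smt (verit) Suc_eq_plus1 image_subsetI length_append mem_Collect_eq)
        then show "foldr S \<xi>s ` word_vectors S V 1 \<subseteq> H (Suc n)"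
          using superset_closure_cspan unfolding H_def by blast
      qed
      then show "x \<in> H (Suc n)" using coinvariant_subset_longer_words[OF coiso co] x by blast
    qed
    then have "closure (cspan (word_vectors S V n)) \<subseteq> H (Suc n)"
      using H by (simp add: closure_cspan_subset_iff)
    then show ?thesis by (simp add: H_def)
  qed
  then have mono: "H m \<subseteq> H n" if "m \<le> n" for m n using lift_Suc_mono_le[of H] that by blast
  have "csubspace (\<Union>n. H n)"
  proof (rule complex_vector.subspaceI)
    fix x y assume "x \<in> (\<Union>n. H n)" "y \<in> (\<Union>n. H n)"
    then obtain m n where "x \<in> H m" "y \<in> H n" by blast
    then have "x + y \<in> H (max m n)"
      using mono[of m "max m n"] mono[of n "max m n"] by (intro closed_csubspaceD[OF H]) auto
    then show "x + y \<in> (\<Union>n. H n)" by blast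
  next
    show "0 \<in> (\<Union>n. H n)" using closed_csubspaceD(1)[OF H] by blast
    show "scaleC c x \<in> (\<Union>n. H n)" if "x \<in> (\<Union>n. H n)" for c x
      using that closed_csubspaceD(4)[OF H] by blast
  qed
  moreover have "(\<Union>n. word_vectors S V n) \<subseteq> (\<Union>n. H n)"
    using superset_closure_cspan unfolding H_def by blast
  ultimately have "cspan (\<Union>n. word_vectors S V n) \<subseteq> (\<Union>n. H n)" by (simp add: cspan_subset_iff)
  moreover have "x \<in> closure (cspan (\<Union>n. word_vectors S V n))"
    using cyc cyclic_iff[OF coinvariantD(2)[OF co]] by simp
  ultimately have "x \<in> closure (\<Union>n. H n)" using closure_mono by blast
  then obtain z n where z: "z \<in> H n" "dist z x < e / 2" using e by (metis UN_E closure_approachable half_gt_zero)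
  then obtain y where y: "y \<in> cspan (word_vectors S V n)" "dist y z < e / 2"
    using e unfolding H_def by (metis closure_approachable half_gt_zero)
  have "dist y x < e" using dist_triangle_half_r[of z y e x] y(2) z(2) by (simp add: dist_commute)
  then show thesis using that y(1) by (simp add: dist_norm norm_minus_commute)
qed

lemma cspan_word_vectors_expansion:
  assumes V: "closed_csubspace V" and y: "y \<in> cspan (word_vectors S V n)"
  obtains I :: "'h set" and \<xi>s v
  where "finite I" "\<And>i. i \<in> I \<Longrightarrow> length (\<xi>s i) = n" "\<And>i. i \<in> I \<Longrightarrow> v i \<in> V"
    "y = (\<Sum>i\<in>I. foldr S (\<xi>s i) (v i))"
proof -
  obtain I r where I: "finite I" "I \<subseteq> word_vectors S V n" and y: "y = (\<Sum>i\<in>I. scaleC (r i) i)"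
    using y unfolding complex_vector.span_explicit by blast
  have "\<forall>i\<in>I. \<exists>\<xi>s v. i = foldr S \<xi>s v \<and> length \<xi>s = n \<and> v \<in> V"
    using I(2) unfolding word_vectors_def by blast
  then obtain \<xi>s v where w: "\<And>i. i \<in> I \<Longrightarrow> i = foldr S (\<xi>s i) (v i) \<and> length (\<xi>s i) = n \<and> v i \<in> V"
    by metis
  have "y = (\<Sum>i\<in>I. foldr S (\<xi>s i) (scaleC (r i) (v i)))"
    unfolding y using w by (intro sum.cong refl) (metis bounded_ops_UNIV_D(2)[OF word_bounded_ops])
  then show thesis
    using that[of I \<xi>s "\<lambda>i. scaleC (r i) (v i)"] I(1) w closed_csubspaceD(4)[OF V] by blast
qed

end

subsection \<open>Operators commuting with the left action\<close>

text \<open>The ratios \<open>N (j + 1) / N j\<close> increase with \<open>j\<close>. If the first one exceeded \<open>c\<close>, the sequence would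
  outgrow every multiple of \<open>c ^ j\<close>.\<close>

lemma log_convex_ratio_le:
  fixes N :: "nat \<Rightarrow> real"
  assumes N0: "\<And>j. 0 \<le> N j" and conv: "\<And>j. (N (Suc j))\<^sup>2 \<le> N j * N (Suc (Suc j))"
    and bound: "\<And>j. N j \<le> C * c ^ j" and c: "0 \<le> c"
  shows "N 1 \<le> c * N 0"
proof (rule ccontr)
  assume "\<not> N 1 \<le> c * N 0"
  then have lt: "c * N 0 < N 1" by simp
  then have N1: "N 1 > 0" using c N0[of 0] by (meson mult_nonneg_nonneg order_le_less_trans)
  have N0pos: "N 0 > 0" using conv[of 0] N0[of 0] N1 by (cases "N 0 = 0") auto
  define r where "r = N 1 / N 0"
  have r: "c < r" using lt N0pos by (simp add: r_def pos_less_divide_eq)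
  have step: "N j > 0 \<and> r * N j \<le> N (Suc j)" for j
  proof (induction j)
    case 0 then show ?case using N0pos by (simp add: r_def)
  next
    case (Suc j)
    then have pos: "N (Suc j) > 0" using r c by (meson mult_pos_pos order_le_less_trans order_less_le_trans)
    have "N j * (r * N (Suc j)) = (r * N j) * N (Suc j)" by simp
    also have "\<dots> \<le> (N (Suc j))\<^sup>2" using Suc pos by (simp add: power2_eq_square)
    also have "\<dots> \<le> N j * N (Suc (Suc j))" by (rule conv)
    finally show ?case using Suc pos by simp
  qed
  have growth: "r ^ j * N 0 \<le> N j" for j
  proof (induction j)
    case (Suc j)
    have "r ^ Suc j * N 0 = r * (r ^ j * N 0)" by simp
    also have "\<dots> \<le> r * N j" using Suc r c by (intro mult_left_mono) auto
    also have "\<dots> \<le> N (Suc j)" using step by blast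
    finally show ?case .
  qed simp
  show False
  proof (cases "c = 0")
    case True
    then show False using bound[of 1] N1 by simp
  next
    case False
    then have cpos: "c > 0" using c by simp
    then obtain j where "C / N 0 < (r / c) ^ j" using real_arch_pow[of "r / c" "C / N 0"] r by auto
    then have "C * c ^ j < r ^ j * N 0" using cpos N0pos by (simp add: field_simps power_divide)
    then show False using growth[of j] bound[of j] by simp
  qed
qed

context isometric_representation
begin

text \<open>In terms of tensor products, \<open>I \<otimes> D\<close> has norm at most that of \<open>D\<close>. Applying \<open>D\<close> to all
  coefficients is symmetric for the positive semidefinite form
  \<open>\<langle>\<Sum> S(\<xi>\<^sub>i) h\<^sub>i, \<Sum> S(\<xi>\<^sub>j) k\<^sub>j\<rangle>\<close>. By the Cauchy-Schwarz inequality the seminorms of its iterates are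
  logarithmically convex, while they grow at most like \<open>c\<^sup>j\<close>.\<close>

lemma word_sum_norm_le:
  assumes sym: "\<And>h k. cinner (D h) k = cinner h (D k)" and comm: "\<And>a h. D (\<sigma> a h) = \<sigma> a (D h)"
    and bd: "\<And>h. norm (D h) \<le> c * norm h" and c: "0 \<le> c"
    and len: "\<And>i. i \<in> I \<Longrightarrow> length (\<xi>s i) = n"
  shows "norm (\<Sum>i\<in>I. foldr S (\<xi>s i) (D (h i))) \<le> c * norm (\<Sum>i\<in>I. foldr S (\<xi>s i) (h i))"
proof -
  define x where "x j = (\<Sum>i\<in>I. foldr S (\<xi>s i) ((D ^^ j) (h i)))" for j
  have shift: "cinner (x (Suc j)) (x k) = cinner (x j) (x (Suc k))" for j k
    unfolding x_def by (simp add: word_sum_gram[where n = n] len sym comm)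
  have conv: "(norm (x (Suc j)))\<^sup>2 \<le> norm (x j) * norm (x (Suc (Suc j)))" for j
  proof -
    have "(norm (x (Suc j)))\<^sup>2 = cmod (cinner (x (Suc j)) (x (Suc j)))"
      by (simp add: cinner_norm norm_power)
    also have "\<dots> \<le> norm (x j) * norm (x (Suc (Suc j)))" unfolding shift by (rule cauchy_schwarz)
    finally show ?thesis .
  qed
  have "\<forall>i. \<exists>K\<ge>0. \<forall>h. norm (foldr S (\<xi>s i) h) \<le> K * norm h"
    using bounded_ops_UNIV_D(3)[OF word_bounded_ops] by blast
  then obtain K where K: "\<And>i. K i \<ge> 0" "\<And>i h. norm (foldr S (\<xi>s i) h) \<le> K i * norm h" by metis
  have iter: "norm ((D ^^ j) v) \<le> c ^ j * norm v" for j v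
  proof (induction j)
    case (Suc j)
    have "norm ((D ^^ Suc j) v) \<le> c * norm ((D ^^ j) v)" using bd by simp
    also have "\<dots> \<le> c * (c ^ j * norm v)" by (intro mult_left_mono Suc c)
    finally show ?case by (simp add: mult.assoc)
  qed simp
  have "norm (x j) \<le> (\<Sum>i\<in>I. K i * norm (h i)) * c ^ j" for j
  proof -
    have "norm (x j) \<le> (\<Sum>i\<in>I. K i * (c ^ j * norm (h i)))"
      unfolding x_def by (intro sum_norm_le order_trans[OF K(2)] mult_left_mono iter K(1))
    then show ?thesis by (simp add: sum_distrib_left mult_ac)
  qed
  then have "norm (x 1) \<le> c * norm (x 0)"
    using conv c by (intro log_convex_ratio_le[of "\<lambda>j. norm (x j)"]) auto
  then show ?thesis by (simp add: x_def)
qed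

subsection \<open>Intersections of cyclic coinvariant subspaces\<close>

lemma coinvariant_Int:
  assumes V: "coinvariant S \<sigma> V" and W: "coinvariant S \<sigma> W"
  shows "coinvariant S \<sigma> (V \<inter> W)"
  using closed_csubspace_Int assms unfolding coinvariant_def by blast

text \<open>Approximate \<open>x \<in> W\<close> by a combination \<open>y\<close> of words of one length applied to vectors of \<open>V\<close>, and split
  each of these vectors into \<open>p i \<in> V \<inter> W\<close> and \<open>w i \<in> V\<close> orthogonal to \<open>V \<inter> W\<close>. The components of the \<open>w i\<close>
  orthogonal to \<open>W\<close> contribute little, since \<open>ortho W\<close> is invariant and \<open>x \<in> W\<close>. But \<open>proj W\<close> shrinks the
  vectors of \<open>V\<close> orthogonal to \<open>V \<inter> W\<close> by a factor \<open>c < 1\<close>, so that this orthogonal part controls the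
  whole contribution of the \<open>w i\<close>, and the \<open>p i\<close> alone already approximate \<open>x\<close>.\<close>

lemma coinvariant_subset_words_of_Int:
  assumes coiso: "closure (cspan (word_vectors S UNIV 1)) = UNIV"
    and coV: "coinvariant S \<sigma> V" and cyc: "cyclic S \<sigma> V" and fin: "finite B" "V \<subseteq> cspan B"
    and coW: "coinvariant S \<sigma> W"
  shows "W \<subseteq> closure (cspan (\<Union>n. word_vectors S (V \<inter> W) n))" (is "W \<subseteq> closure (cspan ?A)")
proof
  fix x assume x: "x \<in> W"
  let ?U = "V \<inter> W"
  let ?N = "V \<inter> ortho ?U"
  have coU: "coinvariant S \<sigma> ?U" by (rule coinvariant_Int[OF coV coW])
  note V = coinvariantD(1)[OF coV] and W = coinvariantD(1)[OF coW] and U = coinvariantD(1)[OF coU]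
  have N: "closed_csubspace ?N" by (intro closed_csubspace_Int V) simp
  have \<sigma>N: "\<sigma> a ` ?N \<subseteq> ?N" for a
    using coinvariantD(3)[OF coV] \<sigma>_ortho[OF coinvariantD(2)[OF coU]] by blast
  have "?N \<inter> W \<subseteq> {0}" using ortho_Int_self[of _ ?U] by blast
  moreover have "?N \<subseteq> cspan B" using fin by blast
  ultimately obtain c where c: "0 \<le> c" "c < 1" and cN: "\<And>v. v \<in> ?N \<Longrightarrow> norm (proj W v) \<le> c * norm v"
    using norm_proj_le_contraction[OF N W fin(1)] by blast
  \<comment> \<open>The compression of \<open>proj W\<close> to \<open>?N\<close>, to be applied to the coefficients of sums of words.\<close>
  define D where "D h = proj ?N (proj W (proj ?N h))" for h
  have D_sym: "cinner (D h) k = cinner h (D k)" for h k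
    unfolding D_def by (simp add: proj_symmetric[OF N] proj_symmetric[OF W])
  have D_comm: "D (\<sigma> a h) = \<sigma> a (D h)" for a h
    unfolding D_def by (simp add: \<sigma>_proj[OF N \<sigma>N] \<sigma>_proj[OF W coinvariantD(2)[OF coW]])
  have D_norm: "norm (D h) \<le> c * norm h" for h
  proof -
    have "norm (D h) \<le> norm (proj W (proj ?N h))" unfolding D_def by (rule norm_proj_le[OF N])
    also have "\<dots> \<le> c * norm (proj ?N h)" by (rule cN[OF proj_in[OF N]])
    also have "\<dots> \<le> c * norm h" by (intro mult_left_mono norm_proj_le[OF N] c)
    finally show ?thesis .
  qed
  show "x \<in> closure (cspan ?A)"
    unfolding closure_approachable
  proof (intro allI impI)
    fix e :: real assume e: "e > 0"
    \<comment> \<open>The errors \<open>norm (x - y)\<close> and \<open>norm (?s w)\<close> are at most \<open>\<delta>\<close> and \<open>\<delta> / (1 - c)\<close>.\<close>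
    define \<delta> where "\<delta> = e * (1 - c) / 2"
    have \<delta>: "\<delta> > 0" using e c by (simp add: \<delta>_def)
    obtain n y where y: "y \<in> cspan (word_vectors S V n)" and xy: "norm (x - y) < \<delta>"
      using approximation_by_words_of_common_length[OF coiso coV cyc \<delta>] .
    obtain I :: "'h set" and \<xi>s v where I: "finite I" and len: "\<And>i. i \<in> I \<Longrightarrow> length (\<xi>s i) = n"
      and vV: "\<And>i. i \<in> I \<Longrightarrow> v i \<in> V" and y_eq: "y = (\<Sum>i\<in>I. foldr S (\<xi>s i) (v i))"
      by (rule cspan_word_vectors_expansion[OF V y]) (rule that)
    define p where "p i = proj ?U (v i)" for i
    define w where "w i = v i - p i" for i
    define q where "q i = proj W (w i)" for i
    let ?s = "\<lambda>h. \<Sum>i\<in>I. foldr S (\<xi>s i) (h i)"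
    have p: "p i \<in> ?U" for i unfolding p_def by (rule proj_in[OF U])
    have w: "w i \<in> ?N" if "i \<in> I" for i
      using closed_csubspaceD(3)[OF V vV[OF that]] p[of i] proj_ortho[OF U, of "v i"]
      by (auto simp: w_def p_def)
    have q: "q i \<in> W" "w i - q i \<in> ortho W" for i
      unfolding q_def by (rule proj_in[OF W] proj_ortho[OF W])+
    have gram0: "cinner (?s h) (?s (\<lambda>i. w i - q i)) = 0" if "\<And>i. h i \<in> W" for h
    proof -
      have "cinner (h i) (\<sigma> a (w j - q j)) = 0" for i j a
        using \<sigma>_ortho[OF coinvariantD(2)[OF coW] q(2)] that by (simp add: ortho_def)
      then show ?thesis by (subst word_sum_gram[where n = n]) (auto simp: len)
    qed
    have s_add: "?s (\<lambda>i. g i + h i) = ?s g + ?s h" for g h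
      by (simp add: bounded_ops_UNIV_D(1)[OF word_bounded_ops] sum.distrib)
    define z where "z = ?s (\<lambda>i. w i - q i)"
    have sw: "?s w = ?s q + z"
      unfolding z_def s_add[symmetric] by simp
    have y_split: "y = ?s p + ?s w"
      unfolding y_eq s_add[symmetric] by (simp add: w_def)
    \<comment> \<open>\<open>z\<close> is the component of \<open>y\<close> in the span of words applied to \<open>ortho W\<close>, to which \<open>x\<close> is orthogonal.\<close>
    have z_le: "norm z \<le> norm (x - y)"
    proof -
      have "z \<in> ortho W"
        unfolding z_def using closed_csubspace_ortho[of W] coinvariantD(5)[OF coW q(2)]
        by (auto simp: closed_csubspace_def intro: complex_vector.subspace_sum)
      then have "cinner x z = 0" using x by (simp add: ortho_def)
      moreover have "cinner y z = cinner z z"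
        using gram0[of p] gram0[of q] p q(1) unfolding z_def[symmetric]
        by (simp add: y_split sw cinner_add_left)
      ultimately have "cinner (y - x) z = (norm z)\<^sup>2" by (simp add: cinner_diff_left cinner_norm)
      then have "(norm z)\<^sup>2 \<le> norm (x - y) * norm z"
        using cauchy_schwarz[of "y - x" z] by (simp add: norm_power norm_minus_commute)
      then show ?thesis by (cases "norm z = 0") (simp_all add: power2_eq_square)
    qed
    \<comment> \<open>Only the compression \<open>D (w i)\<close> of \<open>q i = proj W (w i)\<close> is seen by words applied to \<open>?N\<close>.\<close>
    have "norm (cinner (?s w) (?s q)) \<le> c * (norm (?s w))\<^sup>2"
    proof -
      have "cinner (w i) (\<sigma> a (q j)) = cinner (w i) (\<sigma> a (D (w j)))" if "i \<in> I" "j \<in> I" for i j a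
      proof -
        have "cinner (w i) (\<sigma> a (q j)) = cinner (w i) (proj ?N (\<sigma> a (q j)))"
          by (simp add: cinner_proj[OF N w[OF that(1)]])
        then show ?thesis
          by (simp add: \<sigma>_proj[OF N \<sigma>N] D_def q_def proj_eq_self[OF N w[OF that(2)]])
      qed
      then have "cinner (?s w) (?s q) = cinner (?s w) (?s (\<lambda>i. D (w i)))"
        by (simp add: word_sum_gram[where n = n] len)
      then have "norm (cinner (?s w) (?s q)) \<le> norm (?s w) * norm (?s (\<lambda>i. D (w i)))"
        by (simp add: cauchy_schwarz)
      also have "\<dots> \<le> norm (?s w) * (c * norm (?s w))"
        by (intro mult_left_mono word_sum_norm_le[where n = n, OF D_sym D_comm D_norm c(1)] len) auto
      finally show ?thesis by (simp add: power2_eq_square mult_ac)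
    qed
    moreover have "(norm (?s w))\<^sup>2 \<le> cmod (cinner (?s w) (?s q)) + cmod (cinner (?s w) z)"
    proof -
      have "cinner (?s w) (?s w) = cinner (?s w) (?s q) + cinner (?s w) z"
        unfolding cinner_add_right[symmetric] sw[symmetric] ..
      then have "(norm (?s w))\<^sup>2 = cmod (cinner (?s w) (?s q) + cinner (?s w) z)"
        by (metis cmod_cinner_self)
      then show ?thesis using norm_triangle_ineq by metis
    qed
    ultimately have "(1 - c) * (norm (?s w))\<^sup>2 \<le> norm (?s w) * norm z"
      using cauchy_schwarz[of "?s w" z] by (simp add: left_diff_distrib)
    then have "(1 - c) * norm (?s w) \<le> norm z"
      by (cases "norm (?s w) = 0") (simp_all add: power2_eq_square)
    then have sw_le: "(1 - c) * norm (?s w) < (1 - c) * (e / 2)"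
      using z_le xy by (simp add: \<delta>_def mult_ac)
    have "norm (?s w) < e / 2"
      using mult_less_cancel_left_pos[of "1 - c"] sw_le c by simp
    moreover have "norm (x - y) < e / 2"
    proof -
      have "e * (1 - c) \<le> e" by (rule mult_left_le) (use e c in auto)
      then show ?thesis using xy by (simp add: \<delta>_def)
    qed
    moreover have "norm (x - ?s p) \<le> norm (x - y) + norm (?s w)"
      using norm_triangle_ineq[of "x - y" "?s w"] by (simp add: y_split)
    ultimately have "norm (x - ?s p) < e" by linarith
    moreover have "?s p \<in> cspan ?A"
    proof (rule complex_vector.span_sum)
      fix i assume "i \<in> I"
      have "foldr S (\<xi>s i) (p i) \<in> ?A" using p by (auto simp: word_vectors_def)
      then show "foldr S (\<xi>s i) (p i) \<in> cspan ?A" by (rule complex_vector.span_base)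
    qed
    ultimately show "\<exists>a\<in>cspan ?A. dist a x < e" by (auto simp: dist_norm norm_minus_commute)
  qed
qed

lemma cyclic_Int:
  assumes coiso: "closure (cspan (word_vectors S UNIV 1)) = UNIV"
    and coV: "coinvariant S \<sigma> V" and cycV: "cyclic S \<sigma> V" and fin: "finite B" "V \<subseteq> cspan B"
    and coW: "coinvariant S \<sigma> W" and cycW: "cyclic S \<sigma> W"
  shows "cyclic S \<sigma> (V \<inter> W)"
proof -
  let ?A = "\<Union>n. word_vectors S (V \<inter> W) n"
  let ?M = "closure (cspan ?A)"
  note S = S_maps_word_span[of _ "V \<inter> W"]
  have "word_vectors S W n \<subseteq> ?M" for n
  proof (induction n)
    case 0
    then show ?case
      using coinvariant_subset_words_of_Int[OF coiso coV cycV fin coW] by (simp add: word_vectors_0)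
  next
    case (Suc n)
    then show ?case unfolding word_vectors_Suc using S by blast
  qed
  then have "closure (cspan (\<Union>n. word_vectors S W n)) \<subseteq> ?M"
    by (simp add: closure_cspan_subset_iff UN_subset_iff)
  then have "?M = UNIV" using cycW cyclic_iff[OF coinvariantD(2)[OF coW]] by blast
  then show ?thesis
    using cyclic_iff[OF coinvariantD(2)[OF coinvariant_Int[OF coV coW]]] by blast
qed

text \<open>Intersecting \<open>V\<close> with a finite dimensional cyclic coinvariant subspace shows by minimality that \<open>V\<close>
  is itself finite dimensional. Intersecting \<open>W\<close> with \<open>V\<close> then gives, again by minimality, \<open>V \<inter> W = V\<close>.\<close>

lemma minimal_cyclic_coinvariant_least:
  assumes "fully_coisometric E UNIV S \<sigma>" "finitely_correlated E S \<sigma>"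
    and min: "minimal_cyclic_coinvariant S \<sigma> V"
    and coW: "coinvariant S \<sigma> W" and cycW: "cyclic S \<sigma> W"
  shows "V \<subseteq> W"
proof -
  note coiso = fully_coisometric_dense[OF assms(1)]
  have coV: "coinvariant S \<sigma> V" and cycV: "cyclic S \<sigma> V"
    and least: "\<And>X. X \<subseteq> V \<Longrightarrow> coinvariant S \<sigma> X \<Longrightarrow> cyclic S \<sigma> X \<Longrightarrow> X = V"
    using min unfolding minimal_cyclic_coinvariant_def by blast+
  obtain F where F: "finite_dim F" "coinvariant S \<sigma> F" "cyclic S \<sigma> F"
    using finitely_correlated_cyclic_coinvariant[OF assms(2)] .
  then obtain B where B: "finite B" "F = cspan B" by (auto simp: finite_dim_def)
  have "F \<inter> V = V"
    by (rule least) (auto intro: coinvariant_Int cyclic_Int[OF coiso _ _ B(1)] simp: F coV cycV B(2)[symmetric])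
  then have "V \<subseteq> cspan B" using B(2) by blast
  then have "cyclic S \<sigma> (V \<inter> W)" using cyclic_Int[OF coiso coV cycV B(1) _ coW cycW] by blast
  then have "V \<inter> W = V" using least[of "V \<inter> W"] coinvariant_Int[OF coV coW] by blast
  then show ?thesis by blast
qed

end

section \<open>Unitaries determined by Gram matrices\<close>

text \<open>The premise on \<open>(h', k')\<close> is what it takes for \<open>k'\<close> to be the image of \<open>h'\<close> under a unitary mapping \<open>f i\<close>
  to \<open>g i\<close>. The vectors \<open>h\<close> that have a candidate image \<open>k\<close> compatible with all these pairs form a closed
  subspace, since \<open>norm k = norm h\<close> makes candidate images of a Cauchy sequence Cauchy, and it contains
  every \<open>f i\<close>.\<close>

lemma gram_extension_total:
  fixes f :: "'i \<Rightarrow> 'h::chilbert_space" and g :: "'i \<Rightarrow> 'k::chilbert_space"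
  assumes gram: "\<And>i j. i \<in> I \<Longrightarrow> j \<in> I \<Longrightarrow> cinner (g i) (g j) = cinner (f i) (f j)"
    and dense: "closure (cspan (f ` I)) = UNIV"
  shows "\<exists>k. \<forall>h' k'. (\<forall>i\<in>I. cinner (g i) k' = cinner (f i) h') \<longrightarrow> cinner k' k = cinner h' h"
proof -
  define s where "s h k \<longleftrightarrow>
    (\<forall>h' k'. (\<forall>i\<in>I. cinner (g i) k' = cinner (f i) h') \<longrightarrow> cinner k' k = cinner h' h)" for h k
  have s_fg: "s (f j) (g j)" if j: "j \<in> I" for j
    unfolding s_def
  proof (intro allI impI)
    fix h' k' assume "\<forall>i\<in>I. cinner (g i) k' = cinner (f i) h'"
    then have "cnj (cinner (g j) k') = cnj (cinner (f j) h')" using j by simp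
    then show "cinner k' (g j) = cinner h' (f j)" by (simp flip: cinner_commute)
  qed
  have s_diff: "s (h - h') (k - k')" if "s h k" "s h' k'" for h h' k k'
    using that unfolding s_def cinner_diff_right by metis
  have s_norm: "norm k = norm h" if s: "s h k" for h k
  proof -
    have "cinner (g i) k = cinner (f i) h" if "i \<in> I" for i using s gram that by (simp add: s_def)
    then have "cinner k k = cinner h h" using s by (simp add: s_def)
    then have "(norm k)\<^sup>2 = (norm h)\<^sup>2" unfolding cinner_norm by (simp only: of_real_eq_iff)
    then show ?thesis by simp
  qed
  have "csubspace {h. \<exists>k. s h k}"
  proof (rule complex_vector.subspaceI)
    show "0 \<in> {h. \<exists>k. s h k}" by (auto simp: s_def intro: exI[of _ 0])
    show "x + y \<in> {h. \<exists>k. s h k}" if x: "x \<in> {h. \<exists>k. s h k}" and y: "y \<in> {h. \<exists>k. s h k}" for x y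
    proof -
      obtain k l where "s x k" "s y l" using x y by blast
      then have "s (x + y) (k + l)" unfolding s_def cinner_add_right by metis
      then show ?thesis by blast
    qed
    show "scaleC c x \<in> {h. \<exists>k. s h k}" if x: "x \<in> {h. \<exists>k. s h k}" for c x
    proof -
      obtain k where "s x k" using x by blast
      then have "s (scaleC c x) (scaleC c k)" unfolding s_def cinner_scaleC_right by metis
      then show ?thesis by blast
    qed
  qed
  moreover have "closed {h. \<exists>k. s h k}"
    unfolding closed_sequential_limits
  proof (intro allI impI, elim conjE)
    fix h l assume "\<forall>n. h n \<in> {h. \<exists>k. s h k}" and h: "h \<longlonglongrightarrow> l"
    then obtain k where k: "\<And>n. s (h n) (k n)" by simp metis
    have "norm (k m - k n) = norm (h m - h n)" for m n by (rule s_norm[OF s_diff[OF k k]])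
    then have "Cauchy k"
      using LIMSEQ_imp_Cauchy[OF h] by (simp add: Cauchy_def dist_norm)
    then obtain m where m: "k \<longlonglongrightarrow> m" using Cauchy_convergent convergent_def by blast
    have "s l m"
      unfolding s_def
    proof (intro allI impI)
      fix h' k' assume "\<forall>i\<in>I. cinner (g i) k' = cinner (f i) h'"
      then have "cinner k' (k n) = cinner h' (h n)" for n using k by (simp add: s_def)
      moreover have "(\<lambda>n. cinner k' (k n)) \<longlonglongrightarrow> cinner k' m" by (intro tendsto_cinner tendsto_const m)
      moreover have "(\<lambda>n. cinner h' (h n)) \<longlonglongrightarrow> cinner h' l" by (intro tendsto_cinner tendsto_const h)
      ultimately show "cinner k' m = cinner h' l" using LIMSEQ_unique by simp
    qed
    then show "l \<in> {h. \<exists>k. s h k}" by blast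
  qed
  ultimately have "closed_csubspace {h. \<exists>k. s h k}" by (simp add: closed_csubspace_def)
  moreover have "f ` I \<subseteq> {h. \<exists>k. s h k}" using s_fg by blast
  ultimately have "closure (cspan (f ` I)) \<subseteq> {h. \<exists>k. s h k}" using closure_cspan_subset_iff by blast
  then have "\<exists>k. s h k" using dense by blast
  then show ?thesis by (simp add: s_def)
qed

text \<open>Applied in both directions, the previous lemma gives a total and surjective relation; density makes it
  the graph of a function.\<close>

lemma unitary_of_equal_gram:
  fixes f :: "'i \<Rightarrow> 'h::chilbert_space" and g :: "'i \<Rightarrow> 'k::chilbert_space"
  assumes gram: "\<And>i j. i \<in> I \<Longrightarrow> j \<in> I \<Longrightarrow> cinner (g i) (g j) = cinner (f i) (f j)"
    and f: "closure (cspan (f ` I)) = UNIV" and g: "closure (cspan (g ` I)) = UNIV"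
  shows "\<exists>U. bij U \<and> clinear_on UNIV U \<and> (\<forall>x y. cinner (U x) (U y) = cinner x y)
    \<and> (\<forall>i\<in>I. U (f i) = g i)"
proof -
  define r where "r h k \<longleftrightarrow> (\<forall>i\<in>I. cinner (g i) k = cinner (f i) h)" for h k
  have unique: "k = k'" if "r h k" "r h k'" for h k k'
  proof -
    have "k - k' \<in> ortho (g ` I)" using that by (simp add: r_def ortho_def cinner_diff_right)
    then have "k - k' = 0" using g unfolding dense_cspan_iff by blast
    then show ?thesis by simp
  qed
  have r_fg: "r (f j) (g j)" if "j \<in> I" for j using gram that by (simp add: r_def)
  obtain U where U: "\<And>h h' k'. r h' k' \<Longrightarrow> cinner k' (U h) = cinner h' h"
    using gram_extension_total[where f = f and g = g and I = I, OF gram f] unfolding r_def by metis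
  have rU: "r h (U h)" for h using U[OF r_fg] by (simp add: r_def)
  have iso: "cinner (U x) (U y) = cinner x y" for x y by (rule U[OF rU])
  have lin: "clinear_on UNIV U"
    unfolding clinear_on_def
  proof (intro conjI ballI allI)
    show "U (x + y) = U x + U y" for x y
      by (rule unique[OF rU]) (use rU in \<open>simp add: r_def cinner_add_right\<close>)
    show "U (scaleC c x) = scaleC c (U x)" for c x
      by (rule unique[OF rU]) (use rU in \<open>simp add: r_def cinner_scaleC_right\<close>)
  qed
  have "inj U"
  proof (rule injI)
    fix x y assume eq: "U x = U y"
    have "cinner z (x - y) = 0" for z using iso[of z x] iso[of z y] eq by (simp add: cinner_diff_right)
    then show "x = y" using cinner_self_eq_0[of "x - y"] by simp
  qed
  moreover have "surj U"
  proof (rule surjI)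
    fix k
    obtain h where h: "\<forall>k' h'. (\<forall>i\<in>I. cinner (f i) h' = cinner (g i) k') \<longrightarrow> cinner h' h = cinner k' k"
      using gram_extension_total[where f = g and g = f and I = I, OF gram[symmetric] g] by metis
    have "cinner (f i) h = cinner (g i) k" if "i \<in> I" for i
      using h gram that by simp
    then have "r h k" by (simp add: r_def)
    then have "\<exists>h. U h = k" using unique rU by blast
    then show "U (SOME h. U h = k) = k" by (rule someI_ex)
  qed
  moreover have "U (f i) = g i" if "i \<in> I" for i by (rule unique[OF rU r_fg[OF that]])
  ultimately show ?thesis using lin iso by (intro exI[of _ U]) (simp add: bij_def)
qed

lemma eq_on_dense:
  fixes F G :: "'h::complex_normed_vector \<Rightarrow> 'k::complex_normed_vector"
  assumes F: "bounded_linear F" "\<And>c x. F (scaleC c x) = scaleC c (F x)"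
    and G: "bounded_linear G" "\<And>c x. G (scaleC c x) = scaleC c (G x)"
    and dense: "closure (cspan A) = UNIV" and eq: "\<And>x. x \<in> A \<Longrightarrow> F x = G x"
  shows "F x = G x"
proof -
  have "csubspace {x. F x = G x}"
    by (rule complex_vector.subspaceI) (auto simp: linear_simps[OF F(1)] linear_simps[OF G(1)] F(2) G(2))
  moreover have "closed {x. F x = G x}"
    by (intro closed_Collect_eq linear_continuous_on F(1) G(1))
  ultimately have "closed_csubspace {x. F x = G x}" by (simp add: closed_csubspace_def)
  moreover have "A \<subseteq> {x. F x = G x}" using eq by blast
  ultimately have "closure (cspan A) \<subseteq> {x. F x = G x}" using closure_cspan_subset_iff by blast
  then show ?thesis using dense by blast
qed

lemma bounded_linear_isometry:
  fixes U :: "'h::chilbert_space \<Rightarrow> 'k::chilbert_space"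
  assumes "clinear_on UNIV U" and iso: "\<And>x y. cinner (U x) (U y) = cinner x y"
  shows "bounded_linear U"
proof (rule bounded_linear_intro[of _ 1])
  fix x
  have "(norm (U x))\<^sup>2 = (norm x)\<^sup>2" using iso[of x x] unfolding cinner_norm by (simp only: of_real_eq_iff)
  then show "norm (U x) \<le> norm x * 1" by simp
qed (use assms(1) in \<open>auto simp: clinear_on_def scaleR_scaleC\<close>)

section \<open>Compressions determine the representation\<close>

lemma (in isometric_representation) proj_S:
  assumes co: "coinvariant S \<sigma> V"
  shows "proj V (S \<xi> x) = proj V (S \<xi> (proj V x))"
proof -
  note V = coinvariantD(1)[OF co]
  have "S \<xi> x - S \<xi> (proj V x) \<in> ortho V"
    using coinvariantD(4)[OF co proj_ortho[OF V, of x], of \<xi>]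
    by (simp add: linear_simps[OF bounded_linear_bounded_ops[OF S_bounded_ops]])
  then have "proj V (S \<xi> x - S \<xi> (proj V x)) = 0"
    by (intro proj_unique[OF V]) (simp_all add: closed_csubspaceD(1)[OF V])
  then show ?thesis by (simp add: proj_diff[OF V])
qed

text \<open>After cancelling a common prefix as in the Gram formula, one of the two words is empty. The remaining
  inner product sees only the projection of the other word vector to the subspace, and this projection
  can be computed with the compressions alone, because the complement is invariant.\<close>

lemma word_gram_of_compression:
  assumes repS: "isometric_representation E S \<sigma>" and repT: "isometric_representation E T \<tau>"
    and V: "coinvariant S \<sigma> V" and W: "coinvariant T \<tau> W"
    and UV: "\<And>x. x \<in> V \<Longrightarrow> U x \<in> W"
    and iso: "\<And>x y. x \<in> V \<Longrightarrow> y \<in> V \<Longrightarrow> cinner (U x) (U y) = cinner x y"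
    and US: "\<And>\<xi> x. x \<in> V \<Longrightarrow> U (proj V (S \<xi> x)) = proj W (T \<xi> (U x))"
    and U\<sigma>: "\<And>a x. x \<in> V \<Longrightarrow> U (\<sigma> a x) = \<tau> a (U x)"
    and h: "h \<in> V" and k: "k \<in> V"
  shows "cinner (foldr T \<xi>s (U h)) (foldr T \<eta>s (U k)) = cinner (foldr S \<xi>s h) (foldr S \<eta>s k)"
proof -
  interpret S: isometric_representation E S \<sigma> by (rule repS)
  interpret T: isometric_representation E T \<tau> by (rule repT)
  note cV = S.coinvariantD(1)[OF V] and cW = T.coinvariantD(1)[OF W]
  have compr: "proj W (foldr T \<eta>s (U k)) = U (proj V (foldr S \<eta>s k))" if "k \<in> V" for \<eta>s k
  proof (induction \<eta>s)
    case Nil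
    then show ?case using that UV by (simp add: proj_eq_self[OF cV] proj_eq_self[OF cW])
  next
    case (Cons \<eta> \<eta>s)
    have "proj W (foldr T (\<eta> # \<eta>s) (U k)) = proj W (T \<eta> (U (proj V (foldr S \<eta>s k))))"
      using T.proj_S[OF W, of \<eta> "foldr T \<eta>s (U k)"] Cons by simp
    also have "\<dots> = U (proj V (S \<eta> (proj V (foldr S \<eta>s k))))" by (simp add: US proj_in[OF cV])
    also have "\<dots> = U (proj V (foldr S (\<eta> # \<eta>s) k))"
      using S.proj_S[OF V, of \<eta> "foldr S \<eta>s k"] by simp
    finally show ?case .
  qed
  have one: "cinner (U h) (foldr T \<eta>s (U k)) = cinner h (foldr S \<eta>s k)" if "h \<in> V" "k \<in> V" for \<eta>s h k
  proof -
    have "cinner (U h) (foldr T \<eta>s (U k)) = cinner (U h) (U (proj V (foldr S \<eta>s k)))"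
      by (simp add: cinner_proj[OF cW UV[OF that(1)]] flip: compr[OF that(2)])
    also have "\<dots> = cinner h (foldr S \<eta>s k)"
      by (simp add: iso that(1) proj_in[OF cV] cinner_proj[OF cV])
    finally show ?thesis .
  qed
  show ?thesis
    using k
  proof (induction \<xi>s arbitrary: \<eta>s k)
    case Nil
    then show ?case using one h by simp
  next
    case (Cons \<xi> \<xi>s)
    show ?case
    proof (cases \<eta>s)
      case Nil
      then show ?thesis
        using one[OF Cons.prems h, of "\<xi> # \<xi>s"] by (subst (1 2) cinner_commute) simp
    next
      case \<eta>s: (Cons \<eta> \<eta>s')
      let ?a = "mip E \<xi> \<eta>"
      \<comment> \<open>The coefficient \<open>?a\<close> is absorbed by the next letter, or by the vector if no letter is left.\<close>
      obtain \<zeta>s l where l: "l \<in> V" "\<sigma> ?a (foldr S \<eta>s' k) = foldr S \<zeta>s l"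
        "\<tau> ?a (foldr T \<eta>s' (U k)) = foldr T \<zeta>s (U l)"
      proof (cases \<eta>s')
        case Nil
        then show thesis using that[of "\<sigma> ?a k" "[]"] Cons.prems S.coinvariantD(3)[OF V] U\<sigma> by simp
      next
        case (Cons \<zeta> \<zeta>s)
        then show thesis
          using that[of k "lact E ?a \<zeta> # \<zeta>s"] \<open>k \<in> V\<close> by (simp add: S.\<sigma>_S T.\<sigma>_S)
      qed
      show ?thesis using Cons.IH[OF l(1), of \<zeta>s] by (simp add: \<eta>s S.S_gram T.S_gram l)
    qed
  qed
qed

section \<open>Transport along a unitary\<close>

lemma unitary_image_ortho:
  fixes U :: "'h::chilbert_space \<Rightarrow> 'k::chilbert_space"
  assumes "bij U" and "\<And>x y. cinner (U x) (U y) = cinner x y"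
  shows "U ` ortho A = ortho (U ` A)"
proof
  show "ortho (U ` A) \<subseteq> U ` ortho A"
  proof
    fix y assume y: "y \<in> ortho (U ` A)"
    obtain x where "y = U x" using assms(1) by (metis bij_pointE)
    then show "y \<in> U ` ortho A" using y assms(2) by (auto simp: ortho_def)
  qed
qed (use assms(2) in \<open>auto simp: ortho_def\<close>)

text \<open>Coinvariance and cyclicity have been expressed through orthogonal complements of sets of vectors, and
  a unitary commutes with taking these.\<close>

lemma unitary_image_cyclic_coinvariant:
  assumes repS: "isometric_representation E S \<sigma>" and repT: "isometric_representation E T \<tau>"
    and bij: "bij U" and iso: "\<And>x y. cinner (U x) (U y) = cinner x y"
    and US: "\<And>\<xi> x. U (S \<xi> x) = T \<xi> (U x)" and U\<sigma>: "\<And>a x. U (\<sigma> a x) = \<tau> a (U x)"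
    and V: "coinvariant S \<sigma> V" and cyc: "cyclic S \<sigma> V"
  shows "coinvariant T \<tau> (U ` V)" and "cyclic T \<tau> (U ` V)"
proof -
  interpret S: isometric_representation E S \<sigma> by (rule repS)
  interpret T: isometric_representation E T \<tau> by (rule repT)
  note cV = S.coinvariantD(1)[OF V] and ortho = unitary_image_ortho[OF bij iso]
  have "ortho (ortho V) = V"
    using ortho_ortho[OF cV] by (auto simp: ortho_def cinner_eq_0_commute)
  then have "U ` V = ortho (U ` ortho V)" using ortho[of "ortho V"] by simp
  then have "closed_csubspace (U ` V)" by simp
  moreover have "\<tau> a ` U ` V \<subseteq> U ` V" for a
    using S.coinvariantD(3)[OF V] by (auto simp flip: U\<sigma>)
  moreover have "T \<xi> ` ortho (U ` V) \<subseteq> ortho (U ` V)" for \<xi>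
    using S.coinvariantD(4)[OF V] by (auto simp flip: ortho US)
  ultimately show co: "coinvariant T \<tau> (U ` V)" by (simp add: T.coinvariant_iff)
  have word: "U (foldr S \<xi>s v) = foldr T \<xi>s (U v)" for \<xi>s v by (induction \<xi>s) (simp_all add: US)
  have "word_vectors T (U ` V) n = U ` word_vectors S V n" for n
    unfolding word_vectors_def by (force simp: word)
  then have "(\<Union>n. word_vectors T (U ` V) n) = U ` (\<Union>n. word_vectors S V n)" by blast
  then have "ortho (\<Union>n. word_vectors T (U ` V) n) = U ` ortho (\<Union>n. word_vectors S V n)"
    by (simp only: ortho)
  also have "\<dots> \<subseteq> {0}"
  proof -
    have "U 0 = 0" using iso[of 0 0] by simp
    moreover have "ortho (\<Union>n. word_vectors S V n) \<subseteq> {0}"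
      using cyc S.cyclic_iff[OF S.coinvariantD(2)[OF V]] by (auto simp: dense_cspan_iff)
    ultimately show ?thesis by auto
  qed
  finally show "cyclic T \<tau> (U ` V)"
    unfolding T.cyclic_iff[OF T.coinvariantD(2)[OF co]] dense_cspan_iff by blast
qed

theorem corollary2p28:
  fixes E :: "('a::cstar_algebra, 'e::complex_banach) correspondence"
    and S :: "'e \<Rightarrow> 'h::chilbert_space \<Rightarrow> 'h" and \<sigma> :: "'a \<Rightarrow> 'h \<Rightarrow> 'h"
    and T :: "'e \<Rightarrow> 'k::chilbert_space \<Rightarrow> 'k" and \<tau> :: "'a \<Rightarrow> 'k \<Rightarrow> 'k"
    and V\<^sub>S :: "'h set" and V\<^sub>T :: "'k set"
  assumes "cstar_correspondence E"
    and "corr_representation E UNIV S \<sigma>" and "isometric E UNIV S \<sigma>"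
    and "fully_coisometric E UNIV S \<sigma>" and "finitely_correlated E S \<sigma>"
    and "corr_representation E UNIV T \<tau>" and "isometric E UNIV T \<tau>"
    and "fully_coisometric E UNIV T \<tau>" and "finitely_correlated E T \<tau>"
    and "minimal_cyclic_coinvariant S \<sigma> V\<^sub>S"
    and "minimal_cyclic_coinvariant T \<tau> V\<^sub>T"
  shows "unitarily_equivalent UNIV S \<sigma> UNIV T \<tau> \<longleftrightarrow>
    unitarily_equivalent V\<^sub>S (compression V\<^sub>S S) (restriction V\<^sub>S \<sigma>)
      V\<^sub>T (compression V\<^sub>T T) (restriction V\<^sub>T \<tau>)"
proof -
  interpret S: isometric_representation E S \<sigma> using assms by (intro isometric_representation.intro)
  interpret T: isometric_representation E T \<tau> using assms by (intro isometric_representation.intro)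
  note reps = S.isometric_representation_axioms T.isometric_representation_axioms
  have coS: "coinvariant S \<sigma> V\<^sub>S" and cycS: "cyclic S \<sigma> V\<^sub>S"
    and coT: "coinvariant T \<tau> V\<^sub>T" and cycT: "cyclic T \<tau> V\<^sub>T"
    using assms(10,11) by (simp_all add: minimal_cyclic_coinvariant_def)
  note cS = S.coinvariantD(1)[OF coS] and cT = T.coinvariantD(1)[OF coT]
  show ?thesis
  proof
    assume "unitarily_equivalent UNIV S \<sigma> UNIV T \<tau>"
    then obtain U where bij: "bij U" and lin: "clinear_on UNIV U"
      and iso: "\<And>x y. cinner (U x) (U y) = cinner x y"
      and US: "\<And>\<xi> x. U (S \<xi> x) = T \<xi> (U x)" and U\<sigma>: "\<And>a x. U (\<sigma> a x) = \<tau> a (U x)"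
      by (auto simp: unitarily_equivalent_def)
    let ?U' = "inv U"
    have U': "U (?U' y) = y" "?U' (U x) = x" for x y
      using bij by (simp_all add: bij_is_surj surj_f_inv_f bij_is_inj)
    have iso': "cinner (?U' x) (?U' y) = cinner x y" for x y
      using iso[of "?U' x" "?U' y"] by (simp add: U')
    have US': "?U' (T \<xi> y) = S \<xi> (?U' y)" for \<xi> y using US[of \<xi> "?U' y"] by (metis U')
    have U\<sigma>': "?U' (\<tau> a y) = \<sigma> a (?U' y)" for a y using U\<sigma>[of a "?U' y"] by (metis U')
    have "V\<^sub>T \<subseteq> U ` V\<^sub>S"
      by (intro T.minimal_cyclic_coinvariant_least assms
          unitary_image_cyclic_coinvariant[OF reps bij iso US U\<sigma> coS cycS])
    moreover have "V\<^sub>S \<subseteq> ?U' ` V\<^sub>T"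
      by (intro S.minimal_cyclic_coinvariant_least assms
          unitary_image_cyclic_coinvariant[OF reps(2,1) bij_imp_bij_inv[OF bij] iso' US' U\<sigma>' coT cycT])
    ultimately have image: "U ` V\<^sub>S = V\<^sub>T" using U' by force
    have compr: "U (proj V\<^sub>S x) = proj V\<^sub>T (U x)" for x
    proof (rule proj_unique[OF cT, symmetric])
      show "U (proj V\<^sub>S x) \<in> V\<^sub>T" using image proj_in[OF cS] by blast
      have "U (x - proj V\<^sub>S x) \<in> ortho V\<^sub>T"
        using proj_ortho[OF cS, of x] unitary_image_ortho[OF bij iso, of V\<^sub>S] image by blast
      then show "U x - U (proj V\<^sub>S x) \<in> ortho V\<^sub>T"
        by (simp add: linear_simps[OF bounded_linear_isometry[OF lin iso]])
    qed
    have "bij_betw U V\<^sub>S V\<^sub>T"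
      using image bij by (auto simp: bij_betw_def bij_def intro: inj_on_subset)
    then show "unitarily_equivalent V\<^sub>S (compression V\<^sub>S S) (restriction V\<^sub>S \<sigma>)
        V\<^sub>T (compression V\<^sub>T T) (restriction V\<^sub>T \<tau>)"
      unfolding unitarily_equivalent_def
      using lin image by (intro exI[of _ U])
        (auto simp: clinear_on_def iso compression_def restriction_def compr US U\<sigma>)
  next
    assume "unitarily_equivalent V\<^sub>S (compression V\<^sub>S S) (restriction V\<^sub>S \<sigma>)
        V\<^sub>T (compression V\<^sub>T T) (restriction V\<^sub>T \<tau>)"
    then obtain U where bij: "bij_betw U V\<^sub>S V\<^sub>T"
      and iso: "\<And>x y. x \<in> V\<^sub>S \<Longrightarrow> y \<in> V\<^sub>S \<Longrightarrow> cinner (U x) (U y) = cinner x y"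
      and US0: "\<And>\<xi> x. x \<in> V\<^sub>S \<Longrightarrow> U (compression V\<^sub>S S \<xi> x) = compression V\<^sub>T T \<xi> (U x)"
      and U\<sigma>0: "\<And>a x. x \<in> V\<^sub>S \<Longrightarrow> U (restriction V\<^sub>S \<sigma> a x) = restriction V\<^sub>T \<tau> a (U x)"
      unfolding unitarily_equivalent_def by blast
    have image: "U ` V\<^sub>S = V\<^sub>T" using bij by (simp add: bij_betw_def)
    then have UV: "U x \<in> V\<^sub>T" if "x \<in> V\<^sub>S" for x using that by blast
    have US: "U (proj V\<^sub>S (S \<xi> x)) = proj V\<^sub>T (T \<xi> (U x))" if "x \<in> V\<^sub>S" for \<xi> x
      using US0[OF that] UV[OF that] that by (simp add: compression_def)
    have U\<sigma>: "U (\<sigma> a x) = \<tau> a (U x)" if "x \<in> V\<^sub>S" for a x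
      using U\<sigma>0[OF that] UV[OF that] that by (simp add: restriction_def)
    \<comment> \<open>The word vectors are indexed by pairs of a word and a vector, so that equal Gram matrices give a
    unitary mapping the vectors of \<open>S\<close> to those of \<open>T\<close>.\<close>
    let ?I = "UNIV \<times> V\<^sub>S"
    let ?f = "\<lambda>(\<xi>s, v). foldr S \<xi>s v" and ?g = "\<lambda>(\<xi>s, v). foldr T \<xi>s (U v)"
    have f: "?f ` ?I = (\<Union>n. word_vectors S V\<^sub>S n)" by (force simp: word_vectors_def)
    have g: "?g ` ?I = (\<Union>n. word_vectors T V\<^sub>T n)"
      unfolding image[symmetric] by (force simp: word_vectors_def)
    have dense_f: "closure (cspan (?f ` ?I)) = UNIV"
      using cycS S.cyclic_iff[OF S.coinvariantD(2)[OF coS]] by (simp add: f)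
    have dense_g: "closure (cspan (?g ` ?I)) = UNIV"
      using cycT T.cyclic_iff[OF T.coinvariantD(2)[OF coT]] by (simp add: g)
    have gram: "cinner (?g i) (?g j) = cinner (?f i) (?f j)" if ij: "i \<in> ?I" "j \<in> ?I" for i j
    proof -
      obtain \<xi>s h where i: "i = (\<xi>s, h)" "h \<in> V\<^sub>S" using ij(1) by (rule SigmaE)
      obtain \<eta>s k where j: "j = (\<eta>s, k)" "k \<in> V\<^sub>S" using ij(2) by (rule SigmaE)
      show ?thesis
        unfolding i(1) j(1) prod.case
        by (rule word_gram_of_compression[where U = U, OF reps coS coT UV iso US U\<sigma> i(2) j(2)])
    qed
    obtain X where X: "bij X" "clinear_on UNIV X" "\<And>x y. cinner (X x) (X y) = cinner x y"
      and Xf: "\<And>i. i \<in> ?I \<Longrightarrow> X (?f i) = ?g i"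
      using unitary_of_equal_gram[where f = ?f and g = ?g and I = ?I, OF gram dense_f dense_g] by blast
    have X_word: "X (foldr S \<xi>s v) = foldr T \<xi>s (U v)" if "v \<in> V\<^sub>S" for \<xi>s v
      using Xf[of "(\<xi>s, v)"] that by simp
    have X_bl: "bounded_linear X" by (rule bounded_linear_isometry[OF X(2,3)])
    have X_scale: "X (scaleC c x) = scaleC c (X x)" for c x using X(2) by (simp add: clinear_on_def)
    have intertwine: "X (P x) = Q (X x)"
      if P: "P \<in> bounded_ops UNIV" and Q: "Q \<in> bounded_ops UNIV"
        and PQ: "\<And>\<xi>s v. v \<in> V\<^sub>S \<Longrightarrow> X (P (foldr S \<xi>s v)) = Q (foldr T \<xi>s (U v))" for P Q x
    proof (rule eq_on_dense[OF _ _ _ _ dense_f])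
      show "bounded_linear (\<lambda>x. X (P x))" "bounded_linear (\<lambda>x. Q (X x))"
        by (intro bounded_linear_compose[OF X_bl] bounded_linear_bounded_ops P
            bounded_linear_compose[OF bounded_linear_bounded_ops[OF Q]] X_bl)+
    qed (use PQ X_word in \<open>auto simp: X_scale bounded_ops_UNIV_D(2)[OF P] bounded_ops_UNIV_D(2)[OF Q]\<close>)
    have "X (S \<xi> x) = T \<xi> (X x)" for \<xi> x
    proof (rule intertwine[OF S.S_bounded_ops T.S_bounded_ops])
      show "X (S \<xi> (foldr S \<xi>s v)) = T \<xi> (foldr T \<xi>s (U v))" if "v \<in> V\<^sub>S" for \<xi>s v
        using X_word[OF that, of "\<xi> # \<xi>s"] by simp
    qed
    moreover have "X (\<sigma> a x) = \<tau> a (X x)" for a x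
    proof (rule intertwine[OF S.\<sigma>_bounded_ops T.\<sigma>_bounded_ops])
      fix \<xi>s v assume v: "v \<in> V\<^sub>S"
      show "X (\<sigma> a (foldr S \<xi>s v)) = \<tau> a (foldr T \<xi>s (U v))"
      proof (cases \<xi>s)
        case Nil
        then show ?thesis
          using X_word[OF S.coinvariantD(3)[OF coS v], of "[]" a] by (simp add: U\<sigma>[OF v])
      next
        case (Cons \<xi> \<eta>s)
        then show ?thesis
          using X_word[OF v, of "lact E a \<xi> # \<eta>s"] by (simp add: S.\<sigma>_S T.\<sigma>_S)
      qed
    qed
    ultimately show "unitarily_equivalent UNIV S \<sigma> UNIV T \<tau>"
      unfolding unitarily_equivalent_def using X by auto
  qed
qed

end
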